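(* Consider the open-loop scalar system $\dot X(t)=aX(t)$ with $a>0$, whose initial state $X(0)$ is a random variable with finite differential entropy and $|X(0)|<L$, where $L$ is known to the sensor and the estimator. The sensor communicates with the estimator over the timing channel described in the context, transmitting $n$ symbols, and the delays $\{S_i\}$ are i.i.d. exponentially distributed with mean $\mathbb{E}(S)$. Let $\Gamma>1$. If the timing capacity satisfies $C>a\Gamma$ [nats/sec], then for any sequence of times $\{t_n\}$ with $$1<\lim_{n\to\infty}\frac{t_n}{\mathbb{E}(\mathcal{T}_n)}\le \Gamma,$$ one can (by a suitable choice of encoding by the sensor and estimation by the estimator) compute an estimate $\hat X(t_n)$ such that $|X(t_n)-\hat X(t_n)|\to0$ in probability as $n\to\infty$.
   Context: Timing channel: symbols come from a one-element alphabet. The channel is initialized with a symbol received at time $0$. After the (instantaneous) acknowledgment that the $i$-th symbol was received, the sender waits $W_{i+1}\ge 0$ seconds and then transmits the next symbol, which is received after a random delay $S_{i+1}\ge0$; the delays $\{S_i\}$ are i.i.d. The inter-reception times are $D_i=W_i+S_i$ and $\mathcal{T}_n=\sum_{i=1}^n D_i$. The sensor knows $X(0)$, $L$ and the dynamics and encodes $X(0)$ into the waiting times using a random codebook (codeword entries i.i.d. from a common distribution, independent of $\{S_i\}$); acknowledgments are used only to avoid queuing. The estimator at time $t$ uses the inter-reception times of all symbols received up to time $t$, together with $L$ and the dynamics. Timing capacity: an $(n,M,T,\delta)$-i.i.d.-timing code consists of $M$ codewords of length $n$ with entries drawn i.i.d. from a common distribution and a decoder that from $(D_1,\dots,D_n)$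 selects the transmitted codeword with probability at least $1-\delta$, with $\mathbb{E}(\mathcal{T}_n)\le T$; its rate is $(\log M)/T$. $C$ is the supremum of $R$ such that for every $\gamma>0$ there exist such codes $(n,M_n,T_n,\delta_{T_n})$ with $(\log M_n)/T_n>R-\gamma$ and $\delta_{T_n}\to0$. (For exponential delays it is known that $C=1/(e\,\mathbb{E}(S))$ nats/sec.) *)

theory Defs
  imports "HOL-Probability.Probability"
begin

definition exp_delay :: "real \<Rightarrow> real measure" where
  "exp_delay ES = density lborel (exponential_density (1 / ES))"

text \<open>Random codebook (entries indexed by (message, position), i.i.d. with law P)
  together with the i.i.d. delays S_1, S_2, ... (index 0 is the first transmitted
  symbol after the initial one); codebook independent of the delays.\<close>
definition channel_space :: "real measure \<Rightarrow> real \<Rightarrow> ((nat \<times> nat \<Rightarrow> real) \<times> (nat \<Rightarrow> real)) measure" where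
  "channel_space P ES = (\<Pi>\<^sub>M _\<in>(UNIV::(nat\<times>nat) set). P) \<Otimes>\<^sub>M (\<Pi>\<^sub>M _\<in>(UNIV::nat set). exp_delay ES)"

text \<open>Inter-reception time of the (i+1)-th symbol when message m is sent:
  waiting time (codebook entry) plus channel delay.\<close>
definition inter_time :: "(nat \<times> nat \<Rightarrow> real) \<Rightarrow> (nat \<Rightarrow> real) \<Rightarrow> nat \<Rightarrow> nat \<Rightarrow> real" where
  "inter_time cb S m i = cb (m, i) + S i"

definition waiting_law :: "real measure \<Rightarrow> bool" where
  "waiting_law P \<longleftrightarrow> prob_space P \<and> sets P = sets borel \<and> (AE x in P. 0 \<le> x)
     \<and> integrable P (\<lambda>x. x)"

definition iid_timing_code :: "real \<Rightarrow> nat \<Rightarrow> nat \<Rightarrow> real \<Rightarrow> real \<Rightarrow> bool" where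
  "iid_timing_code ES n M T \<delta> \<longleftrightarrow>
     (\<exists>P dec. waiting_law P \<and>
        (\<forall>m<M.
           (\<integral>\<omega>. (\<Sum>i<n. inter_time (fst \<omega>) (snd \<omega>) m i) \<partial>channel_space P ES) \<le> T \<and>
           {\<omega> \<in> space (channel_space P ES).
               dec (fst \<omega>) (map (inter_time (fst \<omega>) (snd \<omega>) m) [0..<n]) = m}
             \<in> sets (channel_space P ES) \<and>
           measure (channel_space P ES)
             {\<omega> \<in> space (channel_space P ES).
               dec (fst \<omega>) (map (inter_time (fst \<omega>) (snd \<omega>) m) [0..<n]) = (m::nat)} \<ge> 1 - \<delta>))"

definition achievable_rate :: "real \<Rightarrow> real \<Rightarrow> bool" where
  "achievable_rate ES R \<longleftrightarrow>
     (\<forall>\<gamma>>0. \<exists>M T \<delta>. (\<forall>n. iid_timing_code ES n (M n) (T n) (\<delta> n)) \<and>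
        (\<forall>\<^sub>F n in sequentially. ln (real (M n)) / T n > R - \<gamma>) \<and>
        \<delta> \<longlonglongrightarrow> 0)"

definition timing_capacity :: "real \<Rightarrow> real" where
  "timing_capacity ES = Sup {R. achievable_rate ES R}"

definition sys_space :: "real measure \<Rightarrow> real measure \<Rightarrow> real \<Rightarrow>
    (real \<times> (nat \<times> nat \<Rightarrow> real) \<times> (nat \<Rightarrow> real)) measure" where
  "sys_space \<mu> P ES = \<mu> \<Otimes>\<^sub>M channel_space P ES"

definition sys_D :: "(real \<Rightarrow> nat) \<Rightarrow> real \<times> (nat \<times> nat \<Rightarrow> real) \<times> (nat \<Rightarrow> real) \<Rightarrow> nat \<Rightarrow> real" where
  "sys_D enc \<omega> i = inter_time (fst (snd \<omega>)) (snd (snd \<omega>)) (enc (fst \<omega>)) i"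

definition received :: "(real \<Rightarrow> nat) \<Rightarrow> nat \<Rightarrow> real \<Rightarrow> real \<times> (nat \<times> nat \<Rightarrow> real) \<times> (nat \<Rightarrow> real) \<Rightarrow> nat" where
  "received enc n t \<omega> = card {k \<in> {1..n}. (\<Sum>i<k. sys_D enc \<omega> i) \<le> t}"

text \<open>Estimation error |X(t) - hat X(t)| with X(t) = e^{a t} X(0); the estimator
  uses n, t, the (shared) codebook and the inter-reception times received by t.\<close>
definition est_error :: "real \<Rightarrow> (real \<Rightarrow> nat) \<Rightarrow>
    (real \<Rightarrow> (nat \<times> nat \<Rightarrow> real) \<Rightarrow> real list \<Rightarrow> real) \<Rightarrow> nat \<Rightarrow> real \<Rightarrow>
    real \<times> (nat \<times> nat \<Rightarrow> real) \<times> (nat \<Rightarrow> real) \<Rightarrow> real" where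
  "est_error a enc est n t \<omega> =
     \<bar>exp (a * t) * fst \<omega> - est t (fst (snd \<omega>)) (map (sys_D enc \<omega>) [0..<received enc n t \<omega>])\<bar>"

definition expected_Tn :: "real measure \<Rightarrow> real measure \<Rightarrow> real \<Rightarrow> (real \<Rightarrow> nat) \<Rightarrow> nat \<Rightarrow> real" where
  "expected_Tn \<mu> P ES enc n = (\<integral>\<omega>. (\<Sum>i<n. sys_D enc \<omega> i) \<partial>sys_space \<mu> P ES)"

end

theory Submission
  imports Defs
begin

text \<open>
  A code in the definition of the capacity may use a heavy-tailed waiting law that changes with the
  block length, and then the total transmission time need not concentrate around its mean. So the
  given codes are not used for estimation; they only serve to bound the capacity by
  \<open>1 / (exp 1 * ES)\<close>, and the estimator is built from one fixed waiting law.

  Converse: compare the output law of each codeword with i.i.d. exponentials of mean \<open>exp 1 * ES\<close>.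
  The log-likelihood ratio has mean \<open>expected time / (exp 1 * ES)\<close>. It exceeds \<open>1 + \<eta>\<close> times its mean
  with probability at most about \<open>1 / (1 + \<eta>)\<close>, and where it does not, disjointness of the decoding
  regions bounds the number of messages.

  Direct part: if the waiting time vanishes with probability \<open>1 / exp 1\<close> and is exponential with
  mean \<open>exp 1 * ES\<close> otherwise, then inter-reception times are exponential with mean \<open>exp 1 * ES\<close> and
  the log-likelihood ratio has mean one per symbol. All second moments are finite, so Chebyshev's
  inequality gives both reception of all symbols before \<open>t n\<close> and acceptance of the true message by
  a threshold decoder; a wrong message passes the threshold \<open>\<theta> n\<close> with probability at most
  \<open>exp (- \<theta> n)\<close>. Sending one of \<open>exp (\<theta>' n)\<close> quantization cells of the initial state, with
  \<open>a \<Gamma> exp 1 ES < \<theta>' < \<theta> < 1\<close>, leaves a quantization error that beats the growth of the system.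
\<close>

section \<open>Moments and Chebyshev bounds for sums of i.i.d. variables\<close>

text \<open>One induction carries all three claims, because the variance of the enlarged sum needs
  square integrability and the mean of the smaller one. Independence factors the cross term, so
  variances add.\<close>

lemma (in prob_space) indep_vars_sum_moments:
  fixes X :: "'i \<Rightarrow> 'a \<Rightarrow> real" and m v :: real
  assumes "finite I" "indep_vars (\<lambda>_. borel) X I"
    and "\<And>i. i \<in> I \<Longrightarrow> integrable M (\<lambda>\<omega>. (X i \<omega>)\<^sup>2)"
    and "\<And>i. i \<in> I \<Longrightarrow> expectation (X i) = m"
    and "\<And>i. i \<in> I \<Longrightarrow> variance (X i) = v"
  shows "integrable M (\<lambda>\<omega>. (\<Sum>i\<in>I. X i \<omega>)\<^sup>2) \<and> expectation (\<lambda>\<omega>. \<Sum>i\<in>I. X i \<omega>) = card I * m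
     \<and> variance (\<lambda>\<omega>. \<Sum>i\<in>I. X i \<omega>) = card I * v"
  using assms
proof (induction I rule: finite_induct)
  case empty
  then show ?case by simp
next
  case (insert j I)
  let ?S = "\<lambda>\<omega>. \<Sum>i\<in>I. X i \<omega>"
  have ind: "indep_var borel (X j) borel ?S"
    using insert by (intro indep_vars_sum) auto
  have rv [measurable]: "random_variable borel (X j)" "random_variable borel ?S"
    using ind by (auto dest: indep_var_rv1 indep_var_rv2)
  have IH: "integrable M (\<lambda>\<omega>. (?S \<omega>)\<^sup>2)" "expectation ?S = card I * m" "variance ?S = card I * v"
    using insert.IH insert.prems indep_vars_subset[OF insert.prems(1), of I] by auto
  have sqj: "integrable M (\<lambda>\<omega>. (X j \<omega>)\<^sup>2)" and ej: "expectation (X j) = m" and vj: "variance (X j) = v"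
    using insert.prems by auto
  have int [simp]: "integrable M (X j)" "integrable M ?S"
    using sqj IH by (auto intro: square_integrable_imp_integrable)
  have prod: "integrable M (\<lambda>\<omega>. X j \<omega> * ?S \<omega>)"
    "expectation (\<lambda>\<omega>. X j \<omega> * ?S \<omega>) = m * (card I * m)"
    using indep_var_integrable[OF ind int] indep_var_lebesgue_integral[OF ind int] ej IH by auto
  have eq: "(\<lambda>\<omega>. (X j \<omega> + ?S \<omega>)\<^sup>2) = (\<lambda>\<omega>. (X j \<omega>)\<^sup>2 + 2 * (X j \<omega> * ?S \<omega>) + (?S \<omega>)\<^sup>2)"
    by (auto simp: power2_sum algebra_simps)
  have sq: "integrable M (\<lambda>\<omega>. (X j \<omega> + ?S \<omega>)\<^sup>2)"
    unfolding eq using sqj prod IH by (intro Bochner_Integration.integrable_add) auto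
  have e: "expectation (\<lambda>\<omega>. X j \<omega> + ?S \<omega>) = m + card I * m"
    using int ej IH by simp
  have "expectation (\<lambda>\<omega>. (X j \<omega> + ?S \<omega>)\<^sup>2)
      = expectation (\<lambda>\<omega>. (X j \<omega>)\<^sup>2) + 2 * (m * (card I * m)) + expectation (\<lambda>\<omega>. (?S \<omega>)\<^sup>2)"
    unfolding eq using sqj prod IH by simp
  moreover have "variance (X j) = expectation (\<lambda>\<omega>. (X j \<omega>)\<^sup>2) - m\<^sup>2"
    using variance_eq[of "X j"] sqj ej by simp
  moreover have "variance ?S = expectation (\<lambda>\<omega>. (?S \<omega>)\<^sup>2) - (card I * m)\<^sup>2"
    using variance_eq[of ?S] IH by simp
  moreover have "variance (\<lambda>\<omega>. X j \<omega> + ?S \<omega>) = expectation (\<lambda>\<omega>. (X j \<omega> + ?S \<omega>)\<^sup>2) - (m + card I * m)\<^sup>2"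
    using variance_eq[of "\<lambda>\<omega>. X j \<omega> + ?S \<omega>"] sq e by simp
  ultimately have "variance (\<lambda>\<omega>. X j \<omega> + ?S \<omega>) = v + card I * v"
    using vj IH by (simp add: power2_eq_square algebra_simps)
  then show ?case
    using insert.hyps sq e by (simp add: algebra_simps)
qed

text \<open>Independence amounts to the joint law being the product of the marginal laws; here the
  joint map is the identity and every marginal is \<open>P\<close>.\<close>

lemma indep_vars_PiM_components:
  assumes P: "prob_space P"
  shows "prob_space.indep_vars (\<Pi>\<^sub>M _\<in>(UNIV::'i set). P) (\<lambda>_. P) (\<lambda>i x. x i) UNIV"
proof -
  interpret prob_space "\<Pi>\<^sub>M _\<in>(UNIV::'i set). P"
    by (intro prob_space_PiM P)
  have "(\<Pi>\<^sub>M i\<in>(UNIV::'i set). distr (\<Pi>\<^sub>M _\<in>(UNIV::'i set). P) P (\<lambda>x. x i)) = (\<Pi>\<^sub>M _\<in>(UNIV::'i set). P)"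
    using P by (intro PiM_cong refl distr_PiM_component) auto
  then show ?thesis
    by (subst indep_vars_iff_distr_eq_PiM) (auto simp: restrict_UNIV distr_id2)
qed

text \<open>The variance grows like \<open>n\<close> and the squared deviation like the square of
  \<open>n\<close>, hence the decay in \<open>1 / n\<close>. The injection \<open>g\<close> picks
  the summed coordinates: the identity for delays, \<open>\<lambda>i. (m, i)\<close> for the
  codeword of message \<open>m\<close>.\<close>

lemma iid_sum_Chebyshev:
  fixes P :: "real measure" and g :: "nat \<Rightarrow> 'i"
  assumes P: "prob_space P" and sets_P [measurable_cong]: "sets P = sets borel"
    and sq: "integrable P (\<lambda>x. x\<^sup>2)" and g: "inj g" and n: "0 < n" and \<epsilon>: "0 < \<epsilon>"
  defines "m \<equiv> (\<integral>x. x \<partial>P)" and "v \<equiv> (\<integral>x. (x - (\<integral>x. x \<partial>P))\<^sup>2 \<partial>P)"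
  shows "measure (\<Pi>\<^sub>M _\<in>(UNIV::'i set). P)
           {x \<in> space (\<Pi>\<^sub>M _\<in>(UNIV::'i set). P). real n * \<epsilon> \<le> \<bar>(\<Sum>i<n. x (g i)) - real n * m\<bar>}
         \<le> v / \<epsilon>\<^sup>2 / real n"
proof -
  interpret prob_space "\<Pi>\<^sub>M _\<in>(UNIV::'i set). P"
    by (intro prob_space_PiM P)
  have d: "distr (\<Pi>\<^sub>M _\<in>(UNIV::'i set). P) P (\<lambda>x. x i) = P" for i
    using P by (intro distr_PiM_component) auto
  have ind: "indep_vars (\<lambda>_. borel) (\<lambda>i x. x i) (UNIV::'i set)"
    using indep_vars_compose2[OF indep_vars_PiM_components[OF P], of "\<lambda>_ x. x" "\<lambda>_. borel"] by simp
  have r: "expectation (\<lambda>x. h (x i)) = (\<integral>x. h x \<partial>P)"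
    if "h \<in> borel_measurable borel" for h :: "real \<Rightarrow> real" and i
    using that by (subst (2) d[of i, symmetric], subst integral_distr) auto
  have sq': "integrable (\<Pi>\<^sub>M _\<in>(UNIV::'i set). P) (\<lambda>x. (x i)\<^sup>2)" for i
    using sq by (subst (asm) d[of i, symmetric], subst (asm) integrable_distr_eq) auto
  have I: "finite (g ` {..<n})" "card (g ` {..<n}) = n"
    using g by (auto simp: card_image inj_on_subset)
  have s: "(\<Sum>j\<in>g ` {..<n}. x j) = (\<Sum>i<n. x (g i))" for x :: "'i \<Rightarrow> real"
    using g by (subst sum.reindex) (auto intro: inj_on_subset)
  have "integrable (\<Pi>\<^sub>M _\<in>(UNIV::'i set). P) (\<lambda>x. (\<Sum>j\<in>g ` {..<n}. x j)\<^sup>2)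
      \<and> expectation (\<lambda>x. \<Sum>j\<in>g ` {..<n}. x j) = card (g ` {..<n}) * m
      \<and> variance (\<lambda>x. \<Sum>j\<in>g ` {..<n}. x j) = card (g ` {..<n}) * v"
    using I sq' indep_vars_subset[OF ind]
    by (intro indep_vars_sum_moments) (auto simp: m_def v_def r[of "\<lambda>x. x"] r[of "\<lambda>x. (x - (\<integral>x. x \<partial>P))\<^sup>2"])
  note mom = this[unfolded s I]
  have "prob {x \<in> space (\<Pi>\<^sub>M _\<in>(UNIV::'i set). P). real n * \<epsilon> \<le> \<bar>(\<Sum>i<n. x (g i)) - expectation (\<lambda>x. \<Sum>i<n. x (g i))\<bar>}
      \<le> variance (\<lambda>x. \<Sum>i<n. x (g i)) / (real n * \<epsilon>)\<^sup>2"
    using mom n \<epsilon> by (intro Chebyshev_inequality) auto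
  also have "variance (\<lambda>x. \<Sum>i<n. x (g i)) / (real n * \<epsilon>)\<^sup>2 = v / \<epsilon>\<^sup>2 / real n"
    unfolding mom[THEN conjunct2, THEN conjunct2] using n by (simp add: power2_eq_square)
  finally show ?thesis using mom by simp
qed

section \<open>The exponential delay law and its translates\<close>

lemma
  assumes ES: "0 < ES"
  shows prob_space_exp_delay: "prob_space (exp_delay ES)"
    and sets_exp_delay [measurable_cong, simp]: "sets (exp_delay ES) = sets borel"
    and space_exp_delay [simp]: "space (exp_delay ES) = UNIV"
    and exp_delay_integrable_square: "integrable (exp_delay ES) (\<lambda>x. x\<^sup>2)"
    and exp_delay_integrable: "integrable (exp_delay ES) (\<lambda>x. x)"
    and exp_delay_mean: "(\<integral>x. x \<partial>exp_delay ES) = ES"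
    and exp_delay_variance: "(\<integral>x. (x - ES)\<^sup>2 \<partial>exp_delay ES) = ES\<^sup>2"
    and AE_exp_delay_nonneg: "AE x in exp_delay ES. 0 \<le> x"
proof -
  have pos: "0 < 1 / ES" using ES by simp
  show prob: "prob_space (exp_delay ES)"
    unfolding exp_delay_def by (rule prob_space_exponential_density[OF pos])
  then interpret prob_space "exp_delay ES" .
  show sets: "sets (exp_delay ES) = sets borel" and "space (exp_delay ES) = UNIV"
    by (simp_all add: exp_delay_def)
  note [measurable_cong] = sets
  \<comment> \<open>Taking the identity as random variable makes the moment formulas for
    exponentially distributed variables applicable.\<close>
  have D: "distributed (exp_delay ES) lborel (\<lambda>x. x) (exponential_density (1 / ES))"
    unfolding distributed_def using ES
    by (auto simp: exp_delay_def distr_id2)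
  show "integrable (exp_delay ES) (\<lambda>x. x\<^sup>2)"
    using erlang_ith_moment_integrable[OF pos D] .
  show "integrable (exp_delay ES) (\<lambda>x. x)"
    using erlang_ith_moment_integrable[OF pos D, of 1] by simp
  show m: "(\<integral>x. x \<partial>exp_delay ES) = ES"
    using exponential_distributed_expectation[OF pos D] by simp
  show "(\<integral>x. (x - ES)\<^sup>2 \<partial>exp_delay ES) = ES\<^sup>2"
    using exponential_distributed_variance[OF pos D] m by (simp add: power_divide)
  show "AE x in exp_delay ES. 0 \<le> x"
    unfolding exp_delay_def using ES
    by (subst AE_density) (auto simp: exponential_density_def)
qed

text \<open>Density at \<open>d\<close> of \<open>w\<close> plus an exponential delay of mean \<open>ES\<close>, relative to the
  exponential law of mean \<open>exp 1 * ES\<close>. With this reference mean the expected logarithm of the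
  ratio is the expected inter-reception time divided by \<open>exp 1 * ES\<close>.\<close>

definition lratio :: "real \<Rightarrow> real \<Rightarrow> real \<Rightarrow> real" where
  "lratio ES w d = (if d < w then 0 else exp (1 + d / (exp 1 * ES) - (d - w) / ES))"

lemma lratio_measurable [measurable]:
  assumes [measurable]: "f \<in> borel_measurable N" "g \<in> borel_measurable N"
  shows "(\<lambda>x. lratio ES (f x) (g x)) \<in> borel_measurable N"
  unfolding lratio_def by measurable

lemma lratio_nonneg: "0 \<le> lratio ES w d"
  by (simp add: lratio_def)

text \<open>For \<open>d < w\<close> both sides vanish. Otherwise \<open>0 \<le> w \<le> d\<close>,
  both densities are positive, and the summand 1 in the exponent of \<open>lratio\<close> is the
  logarithm of the quotient of the two rates.\<close>

lemma exponential_density_shift: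
  assumes "0 < ES" "0 \<le> w"
  shows "exponential_density (1 / ES) (d - w)
       = exponential_density (1 / (exp 1 * ES)) d * lratio ES w d"
  using assms by (auto simp: exponential_density_def lratio_def exp_add[symmetric] exp_diff field_simps
      simp flip: exp_minus)

text \<open>The substitution \<open>s = d - w\<close> turns the translation into a change of
  Lebesgue density, from which \<open>exponential_density_shift\<close> splits off the reference
  density.\<close>

lemma distr_exp_delay_shift:
  assumes ES: "0 < ES" and w: "0 \<le> w"
  shows "distr (exp_delay ES) borel (\<lambda>s. w + s) = density (exp_delay (exp 1 * ES)) (\<lambda>d. ennreal (lratio ES w d))"
proof (rule measure_eqI)
  have ES': "0 < exp 1 * ES" using ES by simp
  note [measurable_cong] = sets_exp_delay[OF ES] sets_exp_delay[OF ES']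
  show "sets (distr (exp_delay ES) borel (\<lambda>s. w + s)) = sets (density (exp_delay (exp 1 * ES)) (\<lambda>d. ennreal (lratio ES w d)))"
    using ES' by simp
  fix A assume "A \<in> sets (distr (exp_delay ES) borel (\<lambda>s. w + s))"
  then have A [measurable]: "A \<in> sets borel" by simp
  have "emeasure (distr (exp_delay ES) borel (\<lambda>s. w + s)) A = (\<integral>\<^sup>+d. indicator A d \<partial>distr (exp_delay ES) borel (\<lambda>s. w + s))"
    by simp
  also have "\<dots> = (\<integral>\<^sup>+s. indicator A (w + s) \<partial>exp_delay ES)"
    by (subst nn_integral_distr) auto
  also have "\<dots> = (\<integral>\<^sup>+s. ennreal (exponential_density (1 / ES) s) * indicator A (w + s) \<partial>lborel)"
    unfolding exp_delay_def by (subst nn_integral_density) auto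
  also have "\<dots> = (\<integral>\<^sup>+d. ennreal (exponential_density (1 / ES) (d - w)) * indicator A d \<partial>lborel)"
    by (subst nn_integral_real_affine[where c=1 and t="-w"]) auto
  also have "\<dots> = (\<integral>\<^sup>+d. ennreal (exponential_density (1 / (exp 1 * ES)) d) * (ennreal (lratio ES w d) * indicator A d) \<partial>lborel)"
    using ES' by (intro nn_integral_cong)
      (simp add: exponential_density_shift[OF ES w] ennreal_mult' exponential_density_nonneg mult.assoc)
  also have "\<dots> = (\<integral>\<^sup>+d. ennreal (lratio ES w d) * indicator A d \<partial>exp_delay (exp 1 * ES))"
    unfolding exp_delay_def by (subst nn_integral_density) auto
  also have "\<dots> = emeasure (density (exp_delay (exp 1 * ES)) (\<lambda>d. ennreal (lratio ES w d))) A"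
    using ES' by (subst emeasure_density) auto
  finally show "emeasure (distr (exp_delay ES) borel (\<lambda>s. w + s)) A = emeasure (density (exp_delay (exp 1 * ES)) (\<lambda>d. ennreal (lratio ES w d))) A" .
qed

subsection \<open>Change of measure and packing of decoding regions\<close>

text \<open>Both sides agree on boxes with the product of the translated laws \<open>M i\<close>; on
  the right, the integral of a product of functions of separate coordinates factorizes.\<close>

lemma distr_PiM_exp_delay_shift:
  assumes I: "finite I" and ES: "0 < ES" and w: "\<And>i. i \<in> I \<Longrightarrow> 0 \<le> w i"
  shows "distr (\<Pi>\<^sub>M i\<in>I. exp_delay ES) (\<Pi>\<^sub>M i\<in>I. borel) (\<lambda>s. \<lambda>i\<in>I. w i + s i)
       = density (\<Pi>\<^sub>M i\<in>I. exp_delay (exp 1 * ES)) (\<lambda>d. \<Prod>i\<in>I. ennreal (lratio ES (w i) (d i)))"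
    (is "?L = ?R")
proof -
  have ES': "0 < exp 1 * ES" using ES by simp
  note [measurable_cong] = sets_exp_delay[OF ES] sets_exp_delay[OF ES']
  define M where "M i = distr (exp_delay ES) borel (\<lambda>s. w i + s)" for i
  have M: "prob_space (M i)" for i
    unfolding M_def by (intro prob_space.prob_space_distr prob_space_exp_delay ES) simp
  interpret M: product_sigma_finite M
    using M by (auto simp: product_sigma_finite_def prob_space_imp_sigma_finite)
  interpret E: product_sigma_finite "\<lambda>_. exp_delay ES"
    using prob_space_exp_delay[OF ES] by (auto simp: product_sigma_finite_def prob_space_imp_sigma_finite)
  interpret E': product_sigma_finite "\<lambda>_. exp_delay (exp 1 * ES)"
    using prob_space_exp_delay[OF ES'] by (auto simp: product_sigma_finite_def prob_space_imp_sigma_finite)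
  have sets_M [measurable_cong]: "sets (M i) = sets borel" for i by (simp add: M_def)
  have "?L = PiM I M"
  proof (rule M.PiM_eqI[OF I])
    show "sets ?L = sets (PiM I M)" by (auto intro!: sets_PiM_cong simp: sets_M)
    fix A assume A: "\<And>i. i \<in> I \<Longrightarrow> A i \<in> sets (M i)"
    then have A' [measurable]: "i \<in> I \<Longrightarrow> A i \<in> sets borel" for i by (simp add: sets_M)
    have PA: "Pi\<^sub>E I A \<in> sets (\<Pi>\<^sub>M i\<in>I. borel)" by (intro sets_PiM_I_finite I A')
    have "emeasure ?L (Pi\<^sub>E I A) = emeasure (\<Pi>\<^sub>M i\<in>I. exp_delay ES) (\<Pi>\<^sub>E i\<in>I. (\<lambda>s. w i + s) -` A i)"
      using PA ES by (subst emeasure_distr) (auto simp: space_PiM PiE_def Pi_def extensional_def intro!: arg_cong2[where f=emeasure])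
    also have "\<dots> = (\<Prod>i\<in>I. emeasure (exp_delay ES) ((\<lambda>s. w i + s) -` A i))"
    proof (rule E.emeasure_PiM[OF I])
      show "(\<lambda>s. w i + s) -` A i \<in> sets (exp_delay ES)" if "i \<in> I" for i
        using measurable_sets[of "\<lambda>s. w i + s" borel borel "A i"] A'[OF that] ES by simp
    qed
    also have "\<dots> = (\<Prod>i\<in>I. emeasure (M i) (A i))"
      using ES A' by (intro prod.cong refl) (simp add: M_def emeasure_distr)
    finally show "emeasure ?L (Pi\<^sub>E I A) = (\<Prod>i\<in>I. emeasure (M i) (A i))" .
  qed
  moreover have "?R = PiM I M"
  proof (rule M.PiM_eqI[OF I])
    show "sets ?R = sets (PiM I M)" using ES' by (auto intro!: sets_PiM_cong simp: sets_M)
    fix A assume A: "\<And>i. i \<in> I \<Longrightarrow> A i \<in> sets (M i)"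
    then have A' [measurable]: "i \<in> I \<Longrightarrow> A i \<in> sets borel" for i by (simp add: sets_M)
    have PA: "Pi\<^sub>E I A \<in> sets (\<Pi>\<^sub>M i\<in>I. exp_delay (exp 1 * ES))"
      using ES' by (intro sets_PiM_I_finite I) (simp add: A')
    have "emeasure ?R (Pi\<^sub>E I A) = (\<integral>\<^sup>+d. (\<Prod>i\<in>I. ennreal (lratio ES (w i) (d i))) * indicator (Pi\<^sub>E I A) d \<partial>(\<Pi>\<^sub>M i\<in>I. exp_delay (exp 1 * ES)))"
      using PA I by (subst emeasure_density) auto
    also have "\<dots> = (\<integral>\<^sup>+d. (\<Prod>i\<in>I. ennreal (lratio ES (w i) (d i)) * indicator (A i) (d i)) \<partial>(\<Pi>\<^sub>M i\<in>I. exp_delay (exp 1 * ES)))"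
      using I by (intro nn_integral_cong)
        (auto simp: space_PiM PiE_def Pi_def prod.distrib indicator_def intro!: prod_zero split: if_splits)
    also have "\<dots> = (\<Prod>i\<in>I. \<integral>\<^sup>+d. ennreal (lratio ES (w i) d) * indicator (A i) d \<partial>exp_delay (exp 1 * ES))"
    proof (rule E'.product_nn_integral_prod[OF I])
      fix i assume "i \<in> I"
      note [measurable] = A'[OF this]
      show "(\<lambda>d. ennreal (lratio ES (w i) d) * indicator (A i) d) \<in> borel_measurable (exp_delay (exp 1 * ES))"
        by measurable
    qed
    also have "\<dots> = (\<Prod>i\<in>I. emeasure (M i) (A i))"
      using ES' A' w by (intro prod.cong refl)
        (simp add: M_def distr_exp_delay_shift[OF ES] emeasure_density)
    finally show "emeasure ?R (Pi\<^sub>E I A) = (\<Prod>i\<in>I. emeasure (M i) (A i))" .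
  qed
  ultimately show ?thesis by simp
qed

text \<open>In terms of the waiting time \<open>w i\<close> and the delay \<open>d i - w i\<close>
  the exponent of \<open>lratio\<close> is affine, which lets the two sums be estimated separately
  later. If some \<open>d i < w i\<close>, the product is 0 and the bound is trivial.\<close>

lemma prod_lratio_le:
  assumes "0 < ES" "finite I"
    and "(\<Sum>i\<in>I. 1 + w i / (exp 1 * ES) - (1 - 1 / exp 1) / ES * (d i - w i)) \<le> c"
  shows "(\<Prod>i\<in>I. lratio ES (w i) (d i)) \<le> exp c"
proof (cases "\<exists>i\<in>I. d i < w i")
  case True
  then have "(\<Prod>i\<in>I. lratio ES (w i) (d i)) = 0"
    using assms by (auto simp: lratio_def)
  then show ?thesis by simp
next
  case False
  have "1 + d i / (exp 1 * ES) - (d i - w i) / ES = 1 + w i / (exp 1 * ES) - (1 - 1 / exp 1) / ES * (d i - w i)" for i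
    using assms by (simp add: field_simps)
  then have "(\<Prod>i\<in>I. lratio ES (w i) (d i)) = (\<Prod>i\<in>I. exp (1 + w i / (exp 1 * ES) - (1 - 1 / exp 1) / ES * (d i - w i)))"
    using False by (intro prod.cong) (auto simp: lratio_def)
  also have "\<dots> = exp (\<Sum>i\<in>I. 1 + w i / (exp 1 * ES) - (1 - 1 / exp 1) / ES * (d i - w i))"
    using assms by (simp add: exp_sum)
  finally show ?thesis using assms by simp
qed

text \<open>Translated by the codewords, the decoding regions are disjoint, so their probabilities under
  the reference measure add up to at most 1; on \<open>E m\<close> the likelihood ratio is at most \<open>exp c\<close>.\<close>

lemma decoding_regions_packing:
  fixes ES c :: real and n M :: nat and dec :: "real list \<Rightarrow> nat" and w :: "nat \<Rightarrow> nat \<Rightarrow> real"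
  defines "Sp \<equiv> \<Pi>\<^sub>M _\<in>(UNIV::nat set). exp_delay ES"
  defines "E \<equiv> \<lambda>m. {S \<in> space Sp. dec (map (\<lambda>i. w m i + S i) [0..<n]) = m
        \<and> (\<Sum>i<n. 1 + w m i / (exp 1 * ES) - (1 - 1 / exp 1) / ES * S i) \<le> c}"
  assumes ES: "0 < ES" and w: "\<And>m i. 0 \<le> w m i"
    and E: "\<And>m. m < M \<Longrightarrow> E m \<in> sets Sp"
  shows "(\<Sum>m<M. emeasure Sp (E m)) \<le> ennreal (exp c)"
proof -
  have ES': "0 < exp 1 * ES" using ES by simp
  note [measurable_cong] = sets_exp_delay[OF ES] sets_exp_delay[OF ES']
  let ?Q = "\<Pi>\<^sub>M i\<in>{..<n}. exp_delay (exp 1 * ES)"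
  let ?B = "\<Pi>\<^sub>M i\<in>{..<n}. borel :: real measure"
  interpret S: product_prob_space "\<lambda>_. exp_delay ES" "UNIV :: nat set"
    using prob_space_exp_delay[OF ES]
    by (auto simp: product_prob_space_def product_prob_space_axioms_def product_sigma_finite_def prob_space_imp_sigma_finite)
  interpret Q: prob_space ?Q
    by (intro prob_space_PiM prob_space_exp_delay ES')
  have spS: "space Sp = UNIV" using ES by (simp add: Sp_def space_PiM)
  \<comment> \<open>\<open>F m\<close> is \<open>E m\<close> seen from the receiver, in terms of the
    first \<open>n\<close> inter-reception times instead of the delays.\<close>
  define F where "F m = {d \<in> space ?B. dec (map d [0..<n]) = m
        \<and> (\<Sum>i<n. 1 + w m i / (exp 1 * ES) - (1 - 1 / exp 1) / ES * (d i - w m i)) \<le> c}" for m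
  have F: "F m \<in> sets ?B" if "m < M" for m
  proof -
    \<comment> \<open>As \<open>dec\<close> is arbitrary, measurability of \<open>F m\<close> has to
      come from that of \<open>E m\<close>. The padding by 0 is harmless since \<open>E m\<close>
      depends only on the first \<open>n\<close> delays.\<close>
    let ?T = "\<lambda>d i. if i < n then d i - w m i else 0"
    have T: "?T \<in> measurable ?B Sp"
      unfolding Sp_def
    proof (rule measurable_PiM_single')
      show "(\<lambda>d. ?T d i) \<in> measurable ?B (exp_delay ES)" for i
        by (cases "i < n") (simp_all add: measurable_cong_sets[OF refl sets_exp_delay[OF ES]])
    qed (simp add: ES)
    have e1: "map (\<lambda>i. w m i + ?T d i) [0..<n] = map d [0..<n]" for d
      by (rule map_cong) auto
    have e2: "(\<Sum>i<n. 1 + w m i / (exp 1 * ES) - (1 - 1 / exp 1) / ES * ?T d i)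
      = (\<Sum>i<n. 1 + w m i / (exp 1 * ES) - (1 - 1 / exp 1) / ES * (d i - w m i))" for d
      by (rule sum.cong) auto
    have "F m = ?T -` E m \<inter> space ?B"
      unfolding F_def E_def spS vimage_def by (simp only: mem_Collect_eq e1 e2) blast
    then show ?thesis using measurable_sets[OF T E[OF that]] by simp
  qed
  have FQ: "F m \<in> sets ?Q" if "m < M" for m
    using F[OF that] ES' by (simp cong: sets_PiM_cong)
  have le: "emeasure Sp (E m) \<le> ennreal (exp c) * emeasure ?Q (F m)" if m: "m < M" for m
  proof -
    let ?T = "\<lambda>s. \<lambda>i\<in>{..<n}. w m i + s i"
    have T: "?T \<in> measurable Sp ?B" unfolding Sp_def by measurable
    have e1: "map (?T S) [0..<n] = map (\<lambda>i. w m i + S i) [0..<n]" for S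
      by (rule map_cong) auto
    have e2: "(\<Sum>i<n. 1 + w m i / (exp 1 * ES) - (1 - 1 / exp 1) / ES * (?T S i - w m i))
      = (\<Sum>i<n. 1 + w m i / (exp 1 * ES) - (1 - 1 / exp 1) / ES * S i)" for S
      by (rule sum.cong) auto
    have sp: "?T S \<in> space ?B" for S by (simp add: space_PiM)
    have "E m = ?T -` F m \<inter> space Sp"
      unfolding F_def E_def spS vimage_def by (simp only: mem_Collect_eq e1 e2 sp) blast
    then have "emeasure Sp (E m) = emeasure (distr Sp ?B ?T) (F m)"
      using F[OF m] T by (simp add: emeasure_distr)
    \<comment> \<open>The infinite product is replaced by its first \<open>n\<close> factors, where
      the change of measure holds.\<close>
    also have "distr Sp ?B ?T = distr (distr Sp (\<Pi>\<^sub>M i\<in>{..<n}. exp_delay ES) (\<lambda>x. restrict x {..<n})) ?B ?T"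
      unfolding Sp_def by (subst distr_distr) (auto intro!: distr_cong simp: comp_def)
    also have "\<dots> = distr (\<Pi>\<^sub>M i\<in>{..<n}. exp_delay ES) ?B ?T"
      unfolding Sp_def by (subst S.distr_PiM_restrict_finite) auto
    also have "\<dots> = density ?Q (\<lambda>d. \<Prod>i<n. ennreal (lratio ES (w m i) (d i)))"
      using distr_PiM_exp_delay_shift[of "{..<n}" ES "w m"] ES w by simp
    also have "emeasure \<dots> (F m) = (\<integral>\<^sup>+d. (\<Prod>i<n. ennreal (lratio ES (w m i) (d i))) * indicator (F m) d \<partial>?Q)"
      using FQ[OF m] by (intro emeasure_density) auto
    also have "\<dots> \<le> (\<integral>\<^sup>+d. ennreal (exp c) * indicator (F m) d \<partial>?Q)"
    proof (rule nn_integral_mono)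
      fix d
      show "(\<Prod>i<n. ennreal (lratio ES (w m i) (d i))) * indicator (F m) d \<le> ennreal (exp c) * indicator (F m) d"
        using prod_lratio_le[OF ES, of "{..<n}" "w m" d c]
        by (auto simp: indicator_def F_def prod_ennreal lratio_nonneg intro!: ennreal_leI)
    qed
    also have "\<dots> = ennreal (exp c) * emeasure ?Q (F m)"
      using FQ[OF m] by (simp add: nn_integral_cmult)
    finally show ?thesis .
  qed
  have "(\<Sum>m<M. emeasure Sp (E m)) \<le> (\<Sum>m<M. ennreal (exp c) * emeasure ?Q (F m))"
    by (intro sum_mono le) simp
  also have "\<dots> = ennreal (exp c) * emeasure ?Q (\<Union>m<M. F m)"
  proof -
    have "disjoint_family_on F {..<M}" by (auto simp: disjoint_family_on_def F_def)
    then show ?thesis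
      using FQ by (subst sum_emeasure[symmetric]) (auto simp: sum_distrib_left)
  qed
  also have "\<dots> \<le> ennreal (exp c) * 1"
    by (intro mult_left_mono Q.emeasure_le_1) simp
  finally show ?thesis by simp
qed

subsection \<open>The channel and the converse\<close>

lemma waiting_lawD:
  assumes "waiting_law P"
  shows "prob_space P" "sets P = sets borel" "space P = UNIV" "AE x in P. 0 \<le> x" "integrable P (\<lambda>x. x)"
  using assms sets_eq_imp_space_eq[of P borel] by (auto simp: waiting_law_def)

context
  fixes P :: "real measure" and ES :: real
  assumes P: "waiting_law P" and ES: "0 < ES"
begin

interpretation cb: prob_space "\<Pi>\<^sub>M _\<in>(UNIV::(nat\<times>nat) set). P"
  by (intro prob_space_PiM waiting_lawD[OF P])

interpretation S: prob_space "\<Pi>\<^sub>M _\<in>(UNIV::nat set). exp_delay ES"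
  by (intro prob_space_PiM prob_space_exp_delay ES)

lemma prob_space_channel: "prob_space (channel_space P ES)"
  unfolding channel_space_def by (intro prob_space_pair cb.prob_space_axioms S.prob_space_axioms)

lemma sets_channel:
  "sets (channel_space P ES) = sets ((\<Pi>\<^sub>M _\<in>(UNIV::(nat\<times>nat) set). borel) \<Otimes>\<^sub>M (\<Pi>\<^sub>M _\<in>(UNIV::nat set). borel :: real measure))"
  unfolding channel_space_def
  by (intro sets_pair_measure_cong sets_PiM_cong refl) (auto simp: waiting_lawD[OF P] ES)

lemma space_channel: "space (channel_space P ES) = UNIV"
  by (simp add: channel_space_def space_pair_measure space_PiM waiting_lawD[OF P] ES)

lemma distr_channel_fst:
  "distr (channel_space P ES) (\<Pi>\<^sub>M _\<in>(UNIV::(nat\<times>nat) set). P) fst = (\<Pi>\<^sub>M _\<in>(UNIV::(nat\<times>nat) set). P)"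
  unfolding channel_space_def by (rule S.distr_pair_fst)

lemma distr_channel_snd:
  "distr (channel_space P ES) (\<Pi>\<^sub>M _\<in>(UNIV::nat set). exp_delay ES) snd = (\<Pi>\<^sub>M _\<in>(UNIV::nat set). exp_delay ES)"
proof (rule measure_eqI)
  fix A assume "A \<in> sets (distr (channel_space P ES) (\<Pi>\<^sub>M _\<in>(UNIV::nat set). exp_delay ES) snd)"
  then have A: "A \<in> sets (\<Pi>\<^sub>M _\<in>(UNIV::nat set). exp_delay ES)" by simp
  have "snd -` A \<inter> space (channel_space P ES) = space (\<Pi>\<^sub>M _\<in>(UNIV::(nat\<times>nat) set). P) \<times> A"
    using sets.sets_into_space[OF A] by (auto simp: channel_space_def space_pair_measure)
  then show "emeasure (distr (channel_space P ES) (\<Pi>\<^sub>M _\<in>(UNIV::nat set). exp_delay ES) snd) A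
      = emeasure (\<Pi>\<^sub>M _\<in>(UNIV::nat set). exp_delay ES) A"
    using A unfolding channel_space_def
    by (subst emeasure_distr) (auto simp: S.emeasure_pair_measure_Times cb.emeasure_space_1)
qed simp

lemma measurable_channel_fst [measurable]: "fst \<in> measurable (channel_space P ES) (\<Pi>\<^sub>M _\<in>(UNIV::(nat\<times>nat) set). P)"
  by (simp add: channel_space_def)

lemma measurable_channel_snd [measurable]: "snd \<in> measurable (channel_space P ES) (\<Pi>\<^sub>M _\<in>(UNIV::nat set). exp_delay ES)"
  by (simp add: channel_space_def)

lemma distr_channel_waiting: "distr (channel_space P ES) P (\<lambda>\<omega>. fst \<omega> j) = P"
proof -
  have "distr (channel_space P ES) P (\<lambda>\<omega>. fst \<omega> j)
    = distr (distr (channel_space P ES) (\<Pi>\<^sub>M _\<in>(UNIV::(nat\<times>nat) set). P) fst) P (\<lambda>x. x j)"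
    by (subst distr_distr) (auto simp: comp_def)
  then show ?thesis
    unfolding distr_channel_fst using waiting_lawD[OF P] by (simp add: distr_PiM_component[of UNIV "\<lambda>_. P"])
qed

lemma distr_channel_delay: "distr (channel_space P ES) (exp_delay ES) (\<lambda>\<omega>. snd \<omega> i) = exp_delay ES"
proof -
  have "distr (channel_space P ES) (exp_delay ES) (\<lambda>\<omega>. snd \<omega> i)
    = distr (distr (channel_space P ES) (\<Pi>\<^sub>M _\<in>(UNIV::nat set). exp_delay ES) snd) (exp_delay ES) (\<lambda>x. x i)"
    by (subst distr_distr) (auto simp: comp_def)
  then show ?thesis
    unfolding distr_channel_snd using prob_space_exp_delay[OF ES]
    by (simp add: distr_PiM_component[of UNIV "\<lambda>_. exp_delay ES"])
qed

lemma measurable_channel_waiting [measurable]: "(\<lambda>\<omega>. fst \<omega> j) \<in> borel_measurable (channel_space P ES)"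
  and measurable_channel_delay [measurable]: "(\<lambda>\<omega>. snd \<omega> i) \<in> borel_measurable (channel_space P ES)"
  by (auto simp: measurable_cong_sets[OF sets_channel refl])

lemma channel_integrals:
  shows channel_integrable_waiting: "integrable (channel_space P ES) (\<lambda>\<omega>. fst \<omega> j)"
    and channel_integral_waiting: "(\<integral>\<omega>. fst \<omega> j \<partial>channel_space P ES) = (\<integral>x. x \<partial>P)"
    and channel_integrable_delay: "integrable (channel_space P ES) (\<lambda>\<omega>. snd \<omega> i)"
    and channel_integral_delay: "(\<integral>\<omega>. snd \<omega> i \<partial>channel_space P ES) = ES"
    and channel_AE_waiting: "AE \<omega> in channel_space P ES. 0 \<le> fst \<omega> j"
    and channel_AE_delay: "AE \<omega> in channel_space P ES. 0 \<le> snd \<omega> i"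
proof -
  note [measurable_cong] = waiting_lawD(2)[OF P] sets_exp_delay[OF ES]
  show "integrable (channel_space P ES) (\<lambda>\<omega>. fst \<omega> j)"
    using waiting_lawD(5)[OF P]
    by (subst (asm) distr_channel_waiting[of j, symmetric], subst (asm) integrable_distr_eq) auto
  show "(\<integral>\<omega>. fst \<omega> j \<partial>channel_space P ES) = (\<integral>x. x \<partial>P)"
    by (subst (2) distr_channel_waiting[of j, symmetric], subst integral_distr) auto
  show "integrable (channel_space P ES) (\<lambda>\<omega>. snd \<omega> i)"
    using exp_delay_integrable[OF ES]
    by (subst (asm) distr_channel_delay[of i, symmetric], subst (asm) integrable_distr_eq) auto
  show "(\<integral>\<omega>. snd \<omega> i \<partial>channel_space P ES) = ES"
    using exp_delay_mean[OF ES]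
    by (subst (asm) distr_channel_delay[of i, symmetric], subst (asm) integral_distr) auto
  show "AE \<omega> in channel_space P ES. 0 \<le> fst \<omega> j"
    using waiting_lawD(4)[OF P]
    by (subst (asm) distr_channel_waiting[of j, symmetric], subst (asm) AE_distr_iff) auto
  show "AE \<omega> in channel_space P ES. 0 \<le> snd \<omega> i"
    using AE_exp_delay_nonneg[OF ES]
    by (subst (asm) distr_channel_delay[of i, symmetric], subst (asm) AE_distr_iff) auto
qed

lemma channel_expected_time:
  "(\<integral>\<omega>. (\<Sum>i<n. inter_time (fst \<omega>) (snd \<omega>) m i) \<partial>channel_space P ES) = real n * ((\<integral>x. x \<partial>P) + ES)"
  by (simp add: inter_time_def channel_integrals)

lemma channel_delay_Chebyshev:
  assumes "0 < n" "0 < \<epsilon>"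
  shows "measure (channel_space P ES) {\<omega> \<in> space (channel_space P ES). real n * \<epsilon> \<le> \<bar>(\<Sum>i<n. snd \<omega> i) - real n * ES\<bar>}
    \<le> ES\<^sup>2 / \<epsilon>\<^sup>2 / real n"
proof -
  let ?A = "{x \<in> space (\<Pi>\<^sub>M _\<in>(UNIV::nat set). exp_delay ES). real n * \<epsilon> \<le> \<bar>(\<Sum>i<n. x i) - real n * ES\<bar>}"
  note [measurable_cong] = sets_exp_delay[OF ES]
  have "measure (\<Pi>\<^sub>M _\<in>(UNIV::nat set). exp_delay ES) ?A \<le> ES\<^sup>2 / \<epsilon>\<^sup>2 / real n"
    using iid_sum_Chebyshev[OF prob_space_exp_delay[OF ES] sets_exp_delay[OF ES] exp_delay_integrable_square[OF ES],
        of "\<lambda>i. i" n \<epsilon>] assms by (simp add: exp_delay_mean[OF ES] exp_delay_variance[OF ES])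
  also have "measure (\<Pi>\<^sub>M _\<in>(UNIV::nat set). exp_delay ES) ?A
      = measure (distr (channel_space P ES) (\<Pi>\<^sub>M _\<in>(UNIV::nat set). exp_delay ES) snd) ?A"
    by (simp only: distr_channel_snd)
  also have "\<dots> = measure (channel_space P ES) {\<omega> \<in> space (channel_space P ES). real n * \<epsilon> \<le> \<bar>(\<Sum>i<n. snd \<omega> i) - real n * ES\<bar>}"
  proof (subst measure_distr)
    show "?A \<in> sets (\<Pi>\<^sub>M _\<in>(UNIV::nat set). exp_delay ES)" by measurable
  qed (auto intro!: arg_cong2[where f=measure] simp: space_channel space_PiM ES)
  finally show ?thesis .
qed

text \<open>Markov's inequality suffices: the waiting law may depend on the block length, so no law of
  large numbers is available for its sums, but the converse only needs a bound below 1.\<close>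

lemma channel_waiting_Markov:
  assumes \<eta>: "0 < \<eta>"
  shows "measure (channel_space P ES) {\<omega> \<in> space (channel_space P ES). (1 + \<eta>) * (real n * (\<integral>x. x \<partial>P)) < (\<Sum>i<n. fst \<omega> (m, i))}
    \<le> 1 / (1 + \<eta>)"
proof -
  interpret K: prob_space "channel_space P ES" by (rule prob_space_channel)
  let ?W = "\<lambda>\<omega> :: (nat \<times> nat \<Rightarrow> real) \<times> (nat \<Rightarrow> real). \<Sum>i<n. fst \<omega> (m, i)"
  let ?e = "real n * (\<integral>x. x \<partial>P)"
  have int: "integrable (channel_space P ES) ?W" "K.expectation ?W = ?e"
    by (simp_all add: channel_integrals)
  have ae: "AE \<omega> in channel_space P ES. 0 \<le> ?W \<omega>"
  proof -
    have "AE \<omega> in channel_space P ES. \<forall>i\<in>{..<n}. 0 \<le> fst \<omega> (m, i)"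
      by (intro AE_finite_allI channel_AE_waiting) auto
    then show ?thesis by eventually_elim (auto intro: sum_nonneg)
  qed
  have e: "0 \<le> ?e" using integral_nonneg_AE[OF ae] int by simp
  show ?thesis
  proof (cases "?e = 0")
    \<comment> \<open>Markov's inequality divides by the mean, so mean zero is treated apart: the
      nonnegative sum then vanishes almost everywhere.\<close>
    case True
    then have "AE \<omega> in channel_space P ES. ?W \<omega> = 0"
      using integral_nonneg_eq_0_iff_AE[OF int(1) ae] int by simp
    then have "K.prob {\<omega> \<in> space (channel_space P ES). (1 + \<eta>) * ?e < ?W \<omega>} = 0"
      unfolding True by (subst K.prob_eq_0) (auto elim: AE_mp)
    then show ?thesis using \<eta> by simp
  next
    case False
    with e have "0 < ?e" by linarith
    with \<eta> have c: "0 < (1 + \<eta>) * ?e" by (intro mult_pos_pos[of "1 + \<eta>" ?e]) simp_all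
    have "K.prob {\<omega> \<in> space (channel_space P ES). (1 + \<eta>) * ?e < ?W \<omega>} \<le> K.prob {\<omega> \<in> space (channel_space P ES). (1 + \<eta>) * ?e \<le> ?W \<omega>}"
      by (intro K.finite_measure_mono) auto
    also have "\<dots> \<le> K.expectation ?W / ((1 + \<eta>) * ?e)"
      using int(1) ae c by (intro integral_Markov_inequality_measure[of _ _ "space (channel_space P ES)"]) auto
    also have "\<dots> = 1 / (1 + \<eta>)" using int False by simp
    finally show ?thesis .
  qed
qed

text \<open>The sum is the log-likelihood ratio of the sent codeword, and the threshold is
  \<open>1 + \<eta>\<close> times its mean. If the waiting times total at most
  \<open>1 + \<eta>\<close> times their mean, an excess forces the delays far below theirs; Markov
  covers the former event, Chebyshev the latter.\<close>

lemma information_density_tail: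
  assumes \<eta>: "0 < \<eta>" and n: "0 < n"
  shows "measure (channel_space P ES) {\<omega> \<in> space (channel_space P ES).
      (1 + \<eta>) * (real n * ((\<integral>x. x \<partial>P) + ES)) / (exp 1 * ES)
        < (\<Sum>i<n. 1 + fst \<omega> (m, i) / (exp 1 * ES) - (1 - 1 / exp 1) / ES * snd \<omega> i)}
    \<le> 1 / (1 + \<eta>) + (exp 1 - 1)\<^sup>2 / \<eta>\<^sup>2 / real n" (is "measure _ ?A \<le> _")
proof -
  interpret K: prob_space "channel_space P ES" by (rule prob_space_channel)
  let ?e = "real n * (\<integral>x. x \<partial>P)"
  \<comment> \<open>Chosen with \<open>(exp 1 - 1) * ?\<epsilon> = \<eta> * ES\<close>: after
    clearing denominators the delays enter with factor \<open>exp 1 - 1\<close>, and the slack left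
    for them is \<open>\<eta> * n * ES\<close>.\<close>
  let ?\<epsilon> = "\<eta> * ES / (exp 1 - 1)"
  have e1: "0 < exp 1 - (1::real)" by simp
  have \<epsilon>: "0 < ?\<epsilon>" using \<eta> ES e1 by simp
  let ?B = "{\<omega> \<in> space (channel_space P ES). (1 + \<eta>) * ?e < (\<Sum>i<n. fst \<omega> (m, i))}"
  let ?C = "{\<omega> \<in> space (channel_space P ES). real n * ?\<epsilon> \<le> \<bar>(\<Sum>i<n. snd \<omega> i) - real n * ES\<bar>}"
  have "?A \<subseteq> ?B \<union> ?C"
  proof (rule subsetI)
    fix \<omega> assume A: "\<omega> \<in> ?A"
    let ?W = "\<Sum>i<n. fst \<omega> (m, i)" and ?S = "\<Sum>i<n. snd \<omega> i"
    have "(\<Sum>i<n. 1 + fst \<omega> (m, i) / (exp 1 * ES) - (1 - 1 / exp 1) / ES * snd \<omega> i)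
        = real n + ?W / (exp 1 * ES) - (1 - 1 / exp 1) / ES * ?S"
      by (simp add: sum.distrib sum_subtractf sum_distrib_left sum_divide_distrib)
    with A have "(1 + \<eta>) * (?e + real n * ES) / (exp 1 * ES) < real n + ?W / (exp 1 * ES) - (1 - 1 / exp 1) / ES * ?S"
      by (simp add: distrib_left)
    then have "(1 + \<eta>) * (?e + real n * ES) / (exp 1 * ES) * (exp 1 * ES)
        < (real n + ?W / (exp 1 * ES) - (1 - 1 / exp 1) / ES * ?S) * (exp 1 * ES)"
      using ES by (intro mult_strict_right_mono) auto
    also have "(1 + \<eta>) * (?e + real n * ES) / (exp 1 * ES) * (exp 1 * ES) = (1 + \<eta>) * ?e + (1 + \<eta>) * real n * ES"
      using ES by (simp add: distrib_left)
    also have "(real n + ?W / (exp 1 * ES) - (1 - 1 / exp 1) / ES * ?S) * (exp 1 * ES)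
        = real n * exp 1 * ES + ?W - (exp 1 - 1) * ?S"
      using ES by (simp add: field_simps)
    finally have lt: "(1 + \<eta>) * ?e + (1 + \<eta>) * real n * ES < real n * exp 1 * ES + ?W - (exp 1 - 1) * ?S" .
    show "\<omega> \<in> ?B \<union> ?C"
    proof (cases "(1 + \<eta>) * ?e < ?W")
      case True then show ?thesis using A by auto
    next
      case False
      with lt have "\<eta> * real n * ES < (exp 1 - 1) * (real n * ES - ?S)"
        by (simp add: algebra_simps)
      then have "\<eta> * real n * ES / (exp 1 - 1) < real n * ES - ?S"
        using e1 by (simp add: divide_less_eq mult.commute)
      then have "real n * ?\<epsilon> \<le> \<bar>?S - real n * ES\<bar>"
        by (simp add: mult_ac)
      then show ?thesis using A by auto
    qed
  qed
  then have "K.prob ?A \<le> K.prob (?B \<union> ?C)"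
    by (intro K.finite_measure_mono) auto
  also have "\<dots> \<le> K.prob ?B + K.prob ?C"
    by (intro measure_Un_le) auto
  also have "\<dots> \<le> 1 / (1 + \<eta>) + ES\<^sup>2 / ?\<epsilon>\<^sup>2 / real n"
    by (intro add_mono channel_waiting_Markov channel_delay_Chebyshev \<eta> n \<epsilon>)
  also have "ES\<^sup>2 / ?\<epsilon>\<^sup>2 = (exp 1 - 1)\<^sup>2 / \<eta>\<^sup>2"
    using ES by (simp add: power_mult_distrib power_divide)
  finally show ?thesis .
qed

text \<open>The decoder may depend on the codebook, so the codebook is frozen first: each section
  satisfies \<open>decoding_regions_packing\<close>, and the bound survives integration over the
  codebooks.\<close>

lemma codebook_packing:
  fixes dec :: "(nat \<times> nat \<Rightarrow> real) \<Rightarrow> real list \<Rightarrow> nat"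
  assumes dec: "\<And>m. m < M \<Longrightarrow> {\<omega> \<in> space (channel_space P ES).
               dec (fst \<omega>) (map (inter_time (fst \<omega>) (snd \<omega>) m) [0..<n]) = m} \<in> sets (channel_space P ES)"
      (is "\<And>m. m < M \<Longrightarrow> ?A m \<in> _")
  shows "(\<Sum>m<M. measure (channel_space P ES) (?A m \<inter> {\<omega> \<in> space (channel_space P ES).
      (\<Sum>i<n. 1 + fst \<omega> (m, i) / (exp 1 * ES) - (1 - 1 / exp 1) / ES * snd \<omega> i) \<le> c})) \<le> exp c"
    (is "(\<Sum>m<M. measure _ (?A m \<inter> ?G m)) \<le> _")
proof -
  interpret K: prob_space "channel_space P ES" by (rule prob_space_channel)
  let ?N = "\<Pi>\<^sub>M _\<in>(UNIV::(nat\<times>nat) set). P"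
  let ?S = "\<Pi>\<^sub>M _\<in>(UNIV::nat set). exp_delay ES"
  have G: "?A m \<inter> ?G m \<in> sets (channel_space P ES)" if "m < M" for m
    using dec[OF that] by (rule sets.Int) simp
  have chs: "sets (channel_space P ES) = sets (?N \<Otimes>\<^sub>M ?S)" by (simp add: channel_space_def)
  note G' = G[unfolded chs]
  have em: "emeasure (channel_space P ES) X = (\<integral>\<^sup>+cb. emeasure ?S (Pair cb -` X) \<partial>?N)"
    if "X \<in> sets (?N \<Otimes>\<^sub>M ?S)" for X
    unfolding channel_space_def using that by (rule S.emeasure_pair_measure_alt)
  have spS: "space ?S = UNIV" by (simp add: space_PiM ES)
  have sec: "Pair cb -` (?A m \<inter> ?G m) = {S \<in> space ?S. dec cb (map (\<lambda>i. cb (m, i) + S i) [0..<n]) = m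
        \<and> (\<Sum>i<n. 1 + cb (m, i) / (exp 1 * ES) - (1 - 1 / exp 1) / ES * S i) \<le> c}" for cb m
    by (auto simp: space_channel spS inter_time_def[abs_def])
  have "ennreal (\<Sum>m<M. measure (channel_space P ES) (?A m \<inter> ?G m)) = (\<Sum>m<M. emeasure (channel_space P ES) (?A m \<inter> ?G m))"
    by (simp add: K.emeasure_eq_measure sum_ennreal)
  also have "\<dots> = (\<Sum>m<M. \<integral>\<^sup>+cb. emeasure ?S (Pair cb -` (?A m \<inter> ?G m)) \<partial>?N)"
    using G' by (intro sum.cong refl em) auto
  also have "\<dots> = (\<integral>\<^sup>+cb. (\<Sum>m<M. emeasure ?S (Pair cb -` (?A m \<inter> ?G m))) \<partial>?N)"
    using G' by (intro nn_integral_sum[symmetric] S.measurable_emeasure_Pair) auto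
  also have "\<dots> \<le> (\<integral>\<^sup>+cb. ennreal (exp c) \<partial>?N)"
  proof (rule nn_integral_mono_AE)
    \<comment> \<open>The packing bound needs all entries nonnegative at once, which holds almost
      everywhere because there are only countably many.\<close>
    have "AE cb in ?N. \<forall>j. 0 \<le> cb j"
      unfolding AE_all_countable using waiting_lawD[OF P] by (auto intro: AE_PiM_component)
    then show "AE cb in ?N. (\<Sum>m<M. emeasure ?S (Pair cb -` (?A m \<inter> ?G m))) \<le> ennreal (exp c)"
    proof eventually_elim
      case (elim cb)
      show ?case
        unfolding sec
      proof (rule decoding_regions_packing[OF ES])
        fix m assume "m < M"
        then show "{S \<in> space ?S. dec cb (map (\<lambda>i. cb (m, i) + S i) [0..<n]) = m
            \<and> (\<Sum>i<n. 1 + cb (m, i) / (exp 1 * ES) - (1 - 1 / exp 1) / ES * S i) \<le> c} \<in> sets ?S"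
          unfolding sec[symmetric] using G' by (intro sets_Pair1[of _ ?N]) auto
      qed (use elim in auto)
    qed
  qed
  also have "\<dots> = ennreal (exp c)"
    by (simp add: cb.emeasure_space_1)
  finally show ?thesis
    by (subst (asm) ennreal_le_iff) auto
qed

end

section \<open>The converse: upper bound on rates and on the capacity\<close>

text \<open>Here \<open>c\<close> is the exact expected time of the code. It is kept beside its
  bound \<open>T\<close> because \<open>n * ES \<le> c\<close> later yields a gap growing linearly
  in \<open>n\<close>.\<close>

lemma iid_timing_code_bound:
  assumes code: "iid_timing_code ES n M T \<delta>" and ES: "0 < ES" and n: "0 < n" and M: "0 < M" and \<eta>: "0 < \<eta>"
  shows "\<exists>c. 0 \<le> c \<and> real n * ES \<le> c \<and> c \<le> T \<and>
     1 - \<delta> \<le> exp ((1 + \<eta>) * c / (exp 1 * ES)) / real M + (1 / (1 + \<eta>) + (exp 1 - 1)\<^sup>2 / \<eta>\<^sup>2 / real n)"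
proof -
  obtain P dec where P: "waiting_law P"
    and T: "\<And>m. m < M \<Longrightarrow> (\<integral>\<omega>. (\<Sum>i<n. inter_time (fst \<omega>) (snd \<omega>) m i) \<partial>channel_space P ES) \<le> T"
    and A: "\<And>m. m < M \<Longrightarrow> {\<omega> \<in> space (channel_space P ES).
               dec (fst \<omega>) (map (inter_time (fst \<omega>) (snd \<omega>) m) [0..<n]) = m} \<in> sets (channel_space P ES)"
      (is "\<And>m. m < M \<Longrightarrow> ?A m \<in> _")
    and pA: "\<And>m. m < M \<Longrightarrow> 1 - \<delta> \<le> measure (channel_space P ES) {\<omega> \<in> space (channel_space P ES).
               dec (fst \<omega>) (map (inter_time (fst \<omega>) (snd \<omega>) m) [0..<n]) = m}"
    using code unfolding iid_timing_code_def by blast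
  interpret K: prob_space "channel_space P ES" using P ES by (rule prob_space_channel)
  note [measurable] = measurable_channel_waiting[OF P ES] measurable_channel_delay[OF P ES]
  let ?c = "real n * ((\<integral>x. x \<partial>P) + ES)"
  let ?d = "(1 + \<eta>) * ?c / (exp 1 * ES)"
  let ?t = "1 / (1 + \<eta>) + (exp 1 - 1)\<^sup>2 / \<eta>\<^sup>2 / real n"
  have W: "0 \<le> (\<integral>x. x \<partial>P)" using waiting_lawD[OF P] by (intro integral_nonneg_AE)
  let ?J = "\<lambda>m \<omega>. \<Sum>i<n. 1 + fst \<omega> (m, i) / (exp 1 * ES) - (1 - 1 / exp 1) / ES * snd \<omega> i"
  let ?G = "\<lambda>m. {\<omega> \<in> space (channel_space P ES). ?J m \<omega> \<le> ?d}"
  let ?B = "\<lambda>m. {\<omega> \<in> space (channel_space P ES). ?d < ?J m \<omega>}"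
  \<comment> \<open>Summing over the messages is essential: packing bounds only the total of the
    probabilities of correct decoding with a small likelihood ratio.\<close>
  have "real M * (1 - \<delta>) = (\<Sum>m<M. 1 - \<delta>)" by simp
  also have "\<dots> \<le> (\<Sum>m<M. K.prob (?A m \<inter> ?G m) + ?t)"
  proof (rule sum_mono)
    fix m assume m: "m \<in> {..<M}"
    have [measurable]: "?A m \<in> sets (channel_space P ES)" using A m by simp
    have "1 - \<delta> \<le> K.prob (?A m)" using pA m by simp
    also have "\<dots> \<le> K.prob ((?A m \<inter> ?G m) \<union> ?B m)"
      by (intro K.finite_measure_mono) auto
    also have "\<dots> \<le> K.prob (?A m \<inter> ?G m) + K.prob (?B m)"
      by (intro measure_Un_le) auto
    also have "\<dots> \<le> K.prob (?A m \<inter> ?G m) + ?t"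
      using information_density_tail[OF P ES \<eta> n, of m] by simp
    finally show "1 - \<delta> \<le> K.prob (?A m \<inter> ?G m) + ?t" .
  qed
  also have "\<dots> = (\<Sum>m<M. K.prob (?A m \<inter> ?G m)) + real M * ?t"
    by (simp add: sum.distrib)
  also have "\<dots> \<le> exp ?d + real M * ?t"
    using codebook_packing[OF P ES, of M dec n ?d] A by simp
  finally have "1 - \<delta> \<le> exp ?d / real M + ?t"
    using M by (simp add: field_simps)
  moreover have "?c \<le> T" using T[OF M] by (simp add: channel_expected_time[OF P ES])
  moreover have "real n * ES \<le> ?c" using W by (intro mult_left_mono) auto
  ultimately show ?thesis using ES n W by (intro exI[of _ ?c]) auto
qed

text \<open>A larger rate would make \<open>ln (M n)\<close> exceed the exponent of the packing
  bound by a multiple of \<open>n\<close>. The success probability would then be asymptotically at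
  most \<open>1 / (1 + \<eta>) < 1\<close>, contradicting
  \<open>\<delta> \<longlonglongrightarrow> 0\<close>.\<close>

theorem timing_rate_converse:
  assumes R: "achievable_rate ES R" and ES: "0 < ES"
  shows "R \<le> 1 / (exp 1 * ES)"
proof (rule ccontr)
  assume neg: "\<not> ?thesis"
  define l where "l = 1 / (exp 1 * ES)"
  have l: "0 < l" "l < R" using neg ES by (auto simp: l_def)
  \<comment> \<open>The codes then have rate above \<open>(1 + 2 * \<eta>) * l\<close>: one
    \<open>\<eta>\<close> is spent on the tail bound, the other on exponential decay.\<close>
  define \<eta> where "\<eta> = (R - l) / (4 * l)"
  have \<eta>: "0 < \<eta>" using l by (simp add: \<eta>_def)
  have R': "R - (R - l) / 2 = (1 + 2 * \<eta>) * l"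
    using l by (simp add: \<eta>_def field_simps)
  obtain M T \<delta> where code: "\<And>n. iid_timing_code ES n (M n) (T n) (\<delta> n)"
    and rate: "\<forall>\<^sub>F n in sequentially. ln (real (M n)) / T n > R - (R - l) / 2"
    and \<delta>: "\<delta> \<longlonglongrightarrow> 0"
  proof -
    have "0 < (R - l) / 2" using l by simp
    then show ?thesis using that R unfolding achievable_rate_def by blast
  qed
  let ?f = "\<lambda>n. exp (- (\<eta> * l * ES) * real n) + (1 / (1 + \<eta>) + (exp 1 - 1)\<^sup>2 / \<eta>\<^sup>2 / real n)"
  have "\<forall>\<^sub>F n in sequentially. 1 - \<delta> n \<le> ?f n"
    using rate eventually_gt_at_top[of 0]
  proof eventually_elim
    case (elim n)
    \<comment> \<open>Positivity excludes \<open>M n = 0\<close>, since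
      \<open>ln 0 = 0\<close>.\<close>
    have pos: "0 < ln (real (M n)) / T n" using elim R' \<eta> l by (smt (verit) mult_pos_pos)
    then have M: "0 < M n" by (auto intro: gr0I)
    obtain c where c: "0 \<le> c" "real n * ES \<le> c" "c \<le> T n"
      "1 - \<delta> n \<le> exp ((1 + \<eta>) * c / (exp 1 * ES)) / real (M n) + (1 / (1 + \<eta>) + (exp 1 - 1)\<^sup>2 / \<eta>\<^sup>2 / real n)"
      using iid_timing_code_bound[OF code ES elim(2) M \<eta>] by blast
    have "0 < real n * ES" using elim ES by simp
    then have T: "0 < T n" using c by linarith
    have "(1 + 2 * \<eta>) * l * T n < ln (real (M n))"
      using elim T R' by (simp add: pos_less_divide_eq)
    moreover have "(1 + 2 * \<eta>) * l * c \<le> (1 + 2 * \<eta>) * l * T n"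
      using c \<eta> l by (intro mult_left_mono) auto
    moreover have "\<eta> * l * (real n * ES) \<le> \<eta> * l * c"
      using c \<eta> l by (intro mult_left_mono) auto
    ultimately have "(1 + \<eta>) * l * c - ln (real (M n)) \<le> - (\<eta> * l * ES) * real n"
      by (simp add: algebra_simps)
    then have "exp ((1 + \<eta>) * l * c - ln (real (M n))) \<le> exp (- (\<eta> * l * ES) * real n)"
      by simp
    also have "exp ((1 + \<eta>) * l * c - ln (real (M n))) = exp ((1 + \<eta>) * c / (exp 1 * ES)) / real (M n)"
      using M by (simp add: exp_diff l_def)
    finally show ?case using c(4) by linarith
  qed
  moreover have "(\<lambda>n. 1 - \<delta> n) \<longlonglongrightarrow> 1 - 0" by (intro tendsto_intros \<delta>)
  moreover have "?f \<longlonglongrightarrow> 0 + (1 / (1 + \<eta>) + 0)"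
  proof (intro tendsto_add tendsto_const)
    have "0 < \<eta> * l * ES" using \<eta> l ES by simp
    then have "(\<lambda>n. exp (- (\<eta> * l * ES)) ^ n) \<longlonglongrightarrow> 0"
      by (intro LIMSEQ_power_zero) simp
    then show "(\<lambda>n. exp (- (\<eta> * l * ES) * real n)) \<longlonglongrightarrow> 0"
      by (simp add: exp_of_nat_mult[symmetric] mult.commute)
    show "(\<lambda>n. (exp 1 - 1)\<^sup>2 / \<eta>\<^sup>2 / real n) \<longlonglongrightarrow> 0"
      by (rule lim_const_over_n)
  qed
  ultimately have "1 - 0 \<le> 0 + (1 / (1 + \<eta>) + 0)"
    by (intro tendsto_le[OF sequentially_bot, of ?f _ "\<lambda>n. 1 - \<delta> n"])
  then show False using \<eta> by (simp add: field_simps)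
qed

text \<open>Bounding the supremum requires a nonempty set of rates. A code without messages meets
  its conditions vacuously, and its rate \<open>ln 0 / 0\<close> is 0.\<close>

lemma achievable_rate_0:
  assumes ES: "0 < ES"
  shows "achievable_rate ES 0"
proof -
  let ?P = "return borel (0::real)"
  have P: "waiting_law ?P"
    by (auto simp: waiting_law_def prob_space_return AE_return integrable_iff_bounded nn_integral_return)
  have "iid_timing_code ES n 0 0 0" for n
    unfolding iid_timing_code_def using P by blast
  then show ?thesis
    unfolding achievable_rate_def
    by (intro allI impI exI[of _ "\<lambda>_. 0"] conjI) auto
qed

text \<open>This turns the hypothesis on the capacity into
  \<open>a * \<Gamma> * (exp 1 * ES) < 1\<close>, the form that the estimator uses.\<close>

theorem timing_capacity_le:
  assumes ES: "0 < ES"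
  shows "timing_capacity ES \<le> 1 / (exp 1 * ES)"
  unfolding timing_capacity_def
  using achievable_rate_0[OF ES] timing_rate_converse ES by (intro cSup_least) auto

subsection \<open>The optimal waiting-time law\<close>

text \<open>This law, zero with probability \<open>1 / exp 1\<close> and exponential with mean \<open>exp 1 * ES\<close> otherwise,
  is the one whose convolution with the delay law is exponential with mean \<open>exp 1 * ES\<close>.\<close>

definition optimal_waiting :: "real \<Rightarrow> real measure" where
  "optimal_waiting ES = distr (measure_pmf (bernoulli_pmf (1 / exp 1)) \<Otimes>\<^sub>M exp_delay (exp 1 * ES)) borel
     (\<lambda>(b, x). if b then 0 else x)"

lemma inverse_exp_1: "0 \<le> 1 / exp (1::real)" "1 / exp (1::real) \<le> 1"
  by auto

context
  fixes ES :: real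
  assumes ES: "0 < ES"
begin

lemma eES: "0 < exp 1 * ES" using ES by simp

interpretation X: prob_space "exp_delay (exp 1 * ES)"
  by (rule prob_space_exp_delay[OF eES])

lemma sets_optimal_waiting: "sets (optimal_waiting ES) = sets borel"
  by (simp add: optimal_waiting_def)

lemma optimal_waiting_map_measurable:
  "(\<lambda>(b, x). if b then 0 else x) \<in> borel_measurable (measure_pmf (bernoulli_pmf (1 / exp 1)) \<Otimes>\<^sub>M exp_delay (exp 1 * ES))"
proof -
  note [measurable_cong] = sets_exp_delay[OF eES]
  show ?thesis by measurable
qed

text \<open>Integrating out the coin exhibits the law as a mixture, which reduces its sign, moments
  and likelihood integrals to the exponential law.\<close>

lemma nn_integral_optimal_waiting:
  assumes h [measurable]: "h \<in> borel_measurable borel"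
  shows "(\<integral>\<^sup>+x. h x \<partial>optimal_waiting ES)
       = ennreal (1 / exp 1) * h 0 + ennreal (1 - 1 / exp 1) * (\<integral>\<^sup>+x. h x \<partial>exp_delay (exp 1 * ES))"
proof -
  note [measurable_cong] = sets_exp_delay[OF eES]
  note [measurable] = optimal_waiting_map_measurable
  have "(\<integral>\<^sup>+x. h x \<partial>optimal_waiting ES)
    = (\<integral>\<^sup>+y. h (case y of (b, x) \<Rightarrow> if b then 0 else x) \<partial>(measure_pmf (bernoulli_pmf (1 / exp 1)) \<Otimes>\<^sub>M exp_delay (exp 1 * ES)))"
    unfolding optimal_waiting_def by (subst nn_integral_distr) auto
  also have "\<dots> = (\<integral>\<^sup>+b. \<integral>\<^sup>+x. h (if b then 0 else x) \<partial>exp_delay (exp 1 * ES) \<partial>measure_pmf (bernoulli_pmf (1 / exp 1)))"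
    by (subst X.nn_integral_fst[symmetric]) auto
  also have "\<dots> = ennreal (1 / exp 1) * h 0 + ennreal (1 - 1 / exp 1) * (\<integral>\<^sup>+x. h x \<partial>exp_delay (exp 1 * ES))"
    by (subst nn_integral_bernoulli_pmf) (simp_all add: X.emeasure_space_1 mult.commute[of "ennreal _"])
  finally show ?thesis .
qed

lemma prob_space_optimal_waiting: "prob_space (optimal_waiting ES)"
proof -
  interpret pair_prob_space "measure_pmf (bernoulli_pmf (1 / exp 1))" "exp_delay (exp 1 * ES)" ..
  show ?thesis unfolding optimal_waiting_def
    by (intro P.prob_space_distr optimal_waiting_map_measurable)
qed

lemma AE_optimal_waiting_nonneg: "AE x in optimal_waiting ES. 0 \<le> x"
proof -
  note [measurable_cong] = sets_exp_delay[OF eES]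
  have "emeasure (optimal_waiting ES) {x. x < 0} = (\<integral>\<^sup>+x. indicator {x. x < 0} x \<partial>optimal_waiting ES)"
    using sets_optimal_waiting by simp
  also have "\<dots> = ennreal (1 - 1 / exp 1) * (\<integral>\<^sup>+x. indicator {x. x < 0} x \<partial>exp_delay (exp 1 * ES))"
    by (subst nn_integral_optimal_waiting) auto
  also have "(\<integral>\<^sup>+x. indicator {x. x < 0} x \<partial>exp_delay (exp 1 * ES)) = (\<integral>\<^sup>+x. 0 \<partial>exp_delay (exp 1 * ES))"
    using AE_exp_delay_nonneg[OF eES] by (intro nn_integral_cong_AE) auto
  finally have "emeasure (optimal_waiting ES) {x. x < 0} = 0" by simp
  then show ?thesis
    using sets_optimal_waiting sets_eq_imp_space_eq[OF sets_optimal_waiting]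
    by (subst AE_iff_measurable[of "{x. x < 0}"]) (auto simp: not_le)
qed

lemma optimal_waiting_integrable_square: "integrable (optimal_waiting ES) (\<lambda>x. x\<^sup>2)"
proof -
  note [measurable_cong] = sets_optimal_waiting
  have "(\<integral>\<^sup>+x. ennreal (norm (x\<^sup>2)) \<partial>exp_delay (exp 1 * ES)) < \<infinity>"
    using exp_delay_integrable_square[OF eES] unfolding integrable_iff_bounded by blast
  then have "(\<integral>\<^sup>+x. ennreal (norm (x\<^sup>2)) \<partial>optimal_waiting ES) < \<infinity>"
    by (subst nn_integral_optimal_waiting) (auto simp: ennreal_mult_less_top)
  then show ?thesis by (intro integrableI_bounded) auto
qed

lemma waiting_law_optimal_waiting: "waiting_law (optimal_waiting ES)"
proof -
  note [measurable_cong] = sets_optimal_waiting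
  interpret prob_space "optimal_waiting ES" by (rule prob_space_optimal_waiting)
  have "integrable (optimal_waiting ES) (\<lambda>x. x)"
    using optimal_waiting_integrable_square by (rule square_integrable_imp_integrable[rotated]) simp
  then show ?thesis
    by (simp add: waiting_law_def prob_space_optimal_waiting sets_optimal_waiting AE_optimal_waiting_nonneg)
qed

lemma optimal_waiting_mean: "(\<integral>x. x \<partial>optimal_waiting ES) = (exp 1 - 1) * ES"
proof -
  note [measurable_cong] = sets_optimal_waiting sets_exp_delay[OF eES]
  have "(\<integral>\<^sup>+x. ennreal x \<partial>exp_delay (exp 1 * ES)) = ennreal (exp 1 * ES)"
    using nn_integral_eq_integral[OF exp_delay_integrable[OF eES] AE_exp_delay_nonneg[OF eES]]
    by (simp add: exp_delay_mean[OF eES])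
  then have "(\<integral>\<^sup>+x. ennreal x \<partial>optimal_waiting ES) = ennreal (1 - 1 / exp 1) * ennreal (exp 1 * ES)"
    by (subst nn_integral_optimal_waiting) auto
  also have "\<dots> = ennreal ((exp 1 - 1) * ES)"
    using ES by (subst ennreal_mult[symmetric]) (auto simp: field_simps)
  finally show ?thesis
    using ES AE_optimal_waiting_nonneg by (subst integral_eq_nn_integral) auto
qed

text \<open>The integral is the density of the inter-reception time relative to its own law:
  it equals 1 for nonnegative \<open>d\<close> and 0 otherwise.\<close>

lemma nn_integral_lratio_le: "(\<integral>\<^sup>+w. ennreal (lratio ES w d) \<partial>optimal_waiting ES) \<le> 1"
proof (cases "d < 0")
  case True
  have "(\<integral>\<^sup>+w. ennreal (lratio ES w d) \<partial>optimal_waiting ES) = (\<integral>\<^sup>+w. 0 \<partial>optimal_waiting ES)"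
  proof (rule nn_integral_cong_AE)
    show "AE w in optimal_waiting ES. ennreal (lratio ES w d) = 0"
      using AE_optimal_waiting_nonneg by eventually_elim (use True in \<open>simp add: lratio_def\<close>)
  qed
  then show ?thesis by simp
next
  case False
  \<comment> \<open>The exponential waiting density times \<open>lratio\<close> is
    \<open>exp (k * (w - d)) / ES\<close> on \<open>{0..d}\<close>, so \<open>k\<close> is the only
    rate that remains.\<close>
  define k where "k = (1 - 1 / exp 1) / ES"
  have k: "0 < k" using ES by (simp add: k_def)
  have 1: "lratio ES 0 d = exp 1 * exp (- k * d)"
    using False ES by (simp add: lratio_def k_def exp_add[symmetric] field_simps)
  have "(\<integral>\<^sup>+w. ennreal (lratio ES w d) \<partial>exp_delay (exp 1 * ES))
      = (\<integral>\<^sup>+w. ennreal (exponential_density (1 / (exp 1 * ES)) w) * ennreal (lratio ES w d) \<partial>lborel)"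
    unfolding exp_delay_def by (subst nn_integral_density) auto
  also have "\<dots> = (\<integral>\<^sup>+w. ennreal (1 / ES * exp (k * (w - d))) * indicator {0..d} w \<partial>lborel)"
  proof (rule nn_integral_cong)
    fix w
    have "1 / (exp 1 * ES) * exp (- w * (1 / (exp 1 * ES))) * exp (1 + d / (exp 1 * ES) - (d - w) / ES)
        = 1 / ES * exp (k * (w - d))"
    proof -
      have "- w * (1 / (exp 1 * ES)) + (1 + d / (exp 1 * ES) - (d - w) / ES) = 1 + k * (w - d)"
        using ES by (simp add: k_def field_simps)
      then have "exp (- w * (1 / (exp 1 * ES))) * exp (1 + d / (exp 1 * ES) - (d - w) / ES) = exp 1 * exp (k * (w - d))"
        by (simp only: exp_add[symmetric])
      then show ?thesis by (simp add: field_simps)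
    qed
    then show "ennreal (exponential_density (1 / (exp 1 * ES)) w) * ennreal (lratio ES w d)
        = ennreal (1 / ES * exp (k * (w - d))) * indicator {0..d} w"
      using ES by (auto simp: exponential_density_def lratio_def indicator_def ennreal_mult'[symmetric] simp del: ennreal_mult'')
  qed
  also have "\<dots> = ennreal (1 / (k * ES) * exp (k * (d - d)) - 1 / (k * ES) * exp (k * (0 - d)))"
  proof (rule nn_integral_FTC_Icc[where F="\<lambda>w. 1 / (k * ES) * exp (k * (w - d))"])
    fix w
    have "((\<lambda>w. 1 / (k * ES) * exp (k * (w - d))) has_real_derivative 1 / (k * ES) * (exp (k * (w - d)) * k)) (at w)"
      using ES by (auto intro!: derivative_eq_intros)
    then show "((\<lambda>w. 1 / (k * ES) * exp (k * (w - d))) has_real_derivative 1 / ES * exp (k * (w - d))) (at w)"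
      using k ES by (simp add: field_simps)
  qed (use ES False in auto)
  also have "1 / (k * ES) * exp (k * (d - d)) - 1 / (k * ES) * exp (k * (0 - d)) = (1 - exp (- k * d)) / (k * ES)"
    by (simp add: diff_divide_distrib)
  finally have 2: "(\<integral>\<^sup>+w. ennreal (lratio ES w d) \<partial>exp_delay (exp 1 * ES)) = ennreal ((1 - exp (- k * d)) / (k * ES))" .
  \<comment> \<open>The normalization \<open>k * ES\<close> cancels the weight of the exponential
    component. The atom contributes \<open>exp (- k * d)\<close> and the exponential part the
    complementary \<open>1 - exp (- k * d)\<close>.\<close>
  have kES: "k * ES = 1 - 1 / exp 1" using ES by (simp add: k_def)
  have "(\<integral>\<^sup>+w. ennreal (lratio ES w d) \<partial>optimal_waiting ES)
      = ennreal (1 / exp 1) * ennreal (exp 1 * exp (- k * d)) + ennreal (1 - 1 / exp 1) * ennreal ((1 - exp (- k * d)) / (1 - 1 / exp 1))"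
    by (subst nn_integral_optimal_waiting) (auto simp: 1 2 kES)
  also have "\<dots> = ennreal (1 / exp 1 * (exp 1 * exp (- k * d)) + (1 - 1 / exp 1) * ((1 - exp (- k * d)) / (1 - 1 / exp 1)))"
  proof -
    have "0 \<le> (1 - exp (- k * d)) / (1 - 1 / exp 1)" using k False by (intro divide_nonneg_nonneg) auto
    moreover have "0 \<le> 1 - 1 / exp (1::real)" by simp
    ultimately show ?thesis by (simp only: ennreal_mult[symmetric] ennreal_plus[symmetric] inverse_exp_1 exp_ge_zero mult_nonneg_nonneg)
  qed
  also have "1 / exp 1 * (exp 1 * exp (- k * d)) + (1 - 1 / exp 1) * ((1 - exp (- k * d)) / (1 - 1 / exp 1)) = 1"
    by simp
  finally show ?thesis by simp
qed

end

section \<open>Random coding: accepting a wrong message\<close>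

lemma prod_le_1_ennreal:
  fixes f :: "'i \<Rightarrow> ennreal"
  assumes "\<And>i. i \<in> I \<Longrightarrow> f i \<le> 1"
  shows "(\<Prod>i\<in>I. f i) \<le> 1"
  using assms by (induction I rule: infinite_finite_induct) (auto intro: mult_mono[of _ "1::ennreal" _ 1, unfolded mult_1])

text \<open>The codeword of \<open>m'\<close> is independent of that of \<open>m\<close>. With the
  latter and the delays fixed, the integral over the former factorizes into integrals at most 1 by
  \<open>nn_integral_lratio_le\<close>.\<close>

lemma nn_integral_codebook_lratio_le:
  assumes ES: "0 < ES" and m: "m' \<noteq> m"
  shows "(\<integral>\<^sup>+cb. (\<Prod>i<n. ennreal (lratio ES (cb (m', i)) (cb (m, i) + s i)))
       \<partial>(\<Pi>\<^sub>M _\<in>(UNIV::(nat\<times>nat) set). optimal_waiting ES)) \<le> 1"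
proof -
  let ?P = "optimal_waiting ES"
  let ?N = "\<Pi>\<^sub>M _\<in>(UNIV::(nat\<times>nat) set). ?P"
  note P = prob_space_optimal_waiting[OF ES]
  note [measurable_cong] = sets_optimal_waiting[OF ES]
  interpret N: prob_space ?N by (intro prob_space_PiM P)
  \<comment> \<open>\<open>A\<close> and \<open>B\<close> index the two codewords; they are disjoint
    because \<open>m' \<noteq> m\<close>, so the two restrictions of the codebook are
    independent.\<close>
  define A where "A = {m'} \<times> {..<n}"
  define B where "B = {m} \<times> {..<n}"
  let ?A = "\<Pi>\<^sub>M _\<in>A. ?P" and ?B = "\<Pi>\<^sub>M _\<in>B. ?P"
  interpret A: prob_space ?A by (intro prob_space_PiM P)
  interpret B: prob_space ?B by (intro prob_space_PiM P)
  interpret AB: pair_sigma_finite ?A ?B ..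
  interpret Ps: product_prob_space "\<lambda>_. ?P" "UNIV :: (nat \<times> nat) set"
    using P by (auto simp: product_prob_space_def product_prob_space_axioms_def product_sigma_finite_def prob_space_imp_sigma_finite)
  have fin: "finite A" "finite B" by (auto simp: A_def B_def)
  have "N.indep_var ?A (\<lambda>cb. restrict cb A) ?B (\<lambda>cb. restrict cb B)"
    using N.indep_var_restrict[OF indep_vars_PiM_components[OF P], of A B] m by (auto simp: A_def B_def)
  then have "distr ?N ?A (\<lambda>cb. restrict cb A) \<Otimes>\<^sub>M distr ?N ?B (\<lambda>cb. restrict cb B)
      = distr ?N (?A \<Otimes>\<^sub>M ?B) (\<lambda>cb. (restrict cb A, restrict cb B))"
    unfolding N.indep_var_distribution_eq by blast
  then have d: "distr ?N (?A \<Otimes>\<^sub>M ?B) (\<lambda>cb. (restrict cb A, restrict cb B)) = ?A \<Otimes>\<^sub>M ?B"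
    using fin by (simp add: Ps.distr_PiM_restrict_finite)
  let ?f = "\<lambda>(x, y). \<Prod>i<n. ennreal (lratio ES (x (m', i)) (y (m, i) + s i))"
  have cA [measurable]: "(\<lambda>x. x (m', i)) \<in> measurable ?A ?P" if "i \<in> {..<n}" for i
    using that by (intro measurable_component_singleton) (auto simp: A_def)
  have cB [measurable]: "(\<lambda>x. x (m, i)) \<in> measurable ?B ?P" if "i \<in> {..<n}" for i
    using that by (intro measurable_component_singleton) (auto simp: B_def)
  have f [measurable]: "?f \<in> borel_measurable (?A \<Otimes>\<^sub>M ?B)"
  proof -
    have [measurable]: "(\<lambda>p. fst p (m', i)) \<in> borel_measurable (?A \<Otimes>\<^sub>M ?B)"
      "(\<lambda>p. snd p (m, i)) \<in> borel_measurable (?A \<Otimes>\<^sub>M ?B)" if "i \<in> {..<n}" for i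
      using measurable_compose[OF measurable_fst cA[OF that]] measurable_compose[OF measurable_snd cB[OF that]]
      by (simp_all add: measurable_cong_sets[OF refl sets_optimal_waiting[OF ES]])
    show ?thesis
      unfolding case_prod_beta by (intro borel_measurable_prod_ennreal) measurable
  qed
  have "(\<integral>\<^sup>+cb. (\<Prod>i<n. ennreal (lratio ES (cb (m', i)) (cb (m, i) + s i))) \<partial>?N)
      = (\<integral>\<^sup>+cb. ?f (restrict cb A, restrict cb B) \<partial>?N)"
    by (intro nn_integral_cong) (auto simp: A_def B_def intro!: prod.cong)
  also have "\<dots> = (\<integral>\<^sup>+p. ?f p \<partial>distr ?N (?A \<Otimes>\<^sub>M ?B) (\<lambda>cb. (restrict cb A, restrict cb B)))"
    by (subst nn_integral_distr) auto
  also have "\<dots> = (\<integral>\<^sup>+p. ?f p \<partial>(?A \<Otimes>\<^sub>M ?B))"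
    by (simp only: d)
  also have "\<dots> = (\<integral>\<^sup>+y. \<integral>\<^sup>+x. ?f (x, y) \<partial>?A \<partial>?B)"
    by (rule AB.nn_integral_snd[symmetric]) (rule f)
  also have "\<dots> \<le> (\<integral>\<^sup>+y. 1 \<partial>?B)"
  proof (rule nn_integral_mono)
    fix y
    have "(\<integral>\<^sup>+x. ?f (x, y) \<partial>?A) = (\<integral>\<^sup>+x. (\<Prod>j\<in>A. ennreal (lratio ES (x j) (y (m, snd j) + s (snd j)))) \<partial>?A)"
    proof (rule nn_integral_cong)
      fix x
      have "A = Pair m' ` {..<n}" by (auto simp: A_def)
      then show "?f (x, y) = (\<Prod>j\<in>A. ennreal (lratio ES (x j) (y (m, snd j) + s (snd j))))"
        by (simp add: prod.reindex inj_on_def)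
    qed
    also have "\<dots> = (\<Prod>j\<in>A. \<integral>\<^sup>+w. ennreal (lratio ES w (y (m, snd j) + s (snd j))) \<partial>?P)"
      by (rule Ps.product_nn_integral_prod[OF fin(1)]) auto
    also have "\<dots> \<le> (\<Prod>j\<in>A. 1)"
      by (simp add: prod_le_1_ennreal nn_integral_lratio_le[OF ES])
    finally show "(\<integral>\<^sup>+x. ?f (x, y) \<partial>?A) \<le> 1" by simp
  qed
  also have "\<dots> = 1" by (simp add: B.emeasure_space_1)
  finally show ?thesis .
qed

text \<open>Markov's inequality for the likelihood ratio of the wrong codeword, whose expectation is
  at most 1: the codebook is integrated first, for each fixed delay sequence.\<close>

lemma false_acceptance:
  assumes ES: "0 < ES" and m: "m' \<noteq> m"
  shows "measure (channel_space (optimal_waiting ES) ES) {\<omega> \<in> space (channel_space (optimal_waiting ES) ES).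
      exp (\<theta> * real n) < (\<Prod>i<n. lratio ES (fst \<omega> (m', i)) (inter_time (fst \<omega>) (snd \<omega>) m i))}
    \<le> exp (- \<theta> * real n)" (is "measure ?K ?A \<le> _")
proof -
  let ?P = "optimal_waiting ES"
  let ?N = "\<Pi>\<^sub>M _\<in>(UNIV::(nat\<times>nat) set). ?P"
  let ?S = "\<Pi>\<^sub>M _\<in>(UNIV::nat set). exp_delay ES"
  note P = waiting_law_optimal_waiting[OF ES]
  interpret K: prob_space ?K by (rule prob_space_channel[OF P ES])
  note [measurable] = measurable_channel_waiting[OF P ES] measurable_channel_delay[OF P ES]
  interpret N: prob_space ?N by (intro prob_space_PiM prob_space_optimal_waiting ES)
  interpret S: prob_space ?S by (intro prob_space_PiM prob_space_exp_delay ES)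
  interpret NS: pair_sigma_finite ?N ?S ..
  let ?u = "\<lambda>\<omega>. \<Prod>i<n. ennreal (lratio ES (fst \<omega> (m', i)) (fst \<omega> (m, i) + snd \<omega> i))"
  have u: "?u \<in> borel_measurable ?K" by measurable
  have "(\<integral>\<^sup>+\<omega>. ?u \<omega> \<partial>?K) = (\<integral>\<^sup>+s. \<integral>\<^sup>+cb. ?u (cb, s) \<partial>?N \<partial>?S)"
    using u unfolding channel_space_def by (intro NS.nn_integral_snd[symmetric]) auto
  also have "\<dots> \<le> (\<integral>\<^sup>+s. 1 \<partial>?S)"
    using nn_integral_codebook_lratio_le[OF ES m] by (intro nn_integral_mono) simp
  also have "\<dots> = 1" by (simp add: S.emeasure_space_1)
  finally have le: "(\<integral>\<^sup>+\<omega>. ?u \<omega> \<partial>?K) \<le> 1" .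
  have "ennreal (K.prob ?A) = emeasure ?K ?A" by (simp add: K.emeasure_eq_measure)
  also have "\<dots> \<le> emeasure ?K ({\<omega> \<in> space ?K. 1 \<le> ennreal (exp (- \<theta> * real n)) * ?u \<omega>})"
  proof (rule emeasure_mono)
    show "?A \<subseteq> {\<omega> \<in> space ?K. 1 \<le> ennreal (exp (- \<theta> * real n)) * ?u \<omega>}"
    proof safe
      fix cb s assume "exp (\<theta> * real n) < (\<Prod>i<n. lratio ES (fst (cb, s) (m', i)) (inter_time (fst (cb, s)) (snd (cb, s)) m i))"
      then have "exp (\<theta> * real n) < (\<Prod>i<n. lratio ES (cb (m', i)) (cb (m, i) + s i))"
        by (simp add: inter_time_def)
      then have "exp (- \<theta> * real n) * exp (\<theta> * real n) \<le> exp (- \<theta> * real n) * (\<Prod>i<n. lratio ES (cb (m', i)) (cb (m, i) + s i))"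
        by (intro mult_left_mono) auto
      also have "exp (- \<theta> * real n) * exp (\<theta> * real n) = 1" by (simp add: exp_add[symmetric])
      finally have "ennreal 1 \<le> ennreal (exp (- \<theta> * real n) * (\<Prod>i<n. lratio ES (cb (m', i)) (cb (m, i) + s i)))"
        by (rule ennreal_leI)
      then show "1 \<le> ennreal (exp (- \<theta> * real n)) * ?u (cb, s)"
        by (simp add: ennreal_mult prod_ennreal lratio_nonneg prod_nonneg)
    qed
  qed measurable
  also have "\<dots> \<le> ennreal (exp (- \<theta> * real n)) * (\<integral>\<^sup>+\<omega>. ?u \<omega> * indicator (space ?K) \<omega> \<partial>?K)"
    using u by (intro nn_integral_Markov_inequality) auto
  also have "(\<integral>\<^sup>+\<omega>. ?u \<omega> * indicator (space ?K) \<omega> \<partial>?K) = (\<integral>\<^sup>+\<omega>. ?u \<omega> \<partial>?K)"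
    by (intro nn_integral_cong) simp
  also have "ennreal (exp (- \<theta> * real n)) * \<dots> \<le> ennreal (exp (- \<theta> * real n)) * 1"
    by (intro mult_left_mono le) simp
  finally show ?thesis by simp
qed

text \<open>For a fixed waiting law with finite second moment this tail vanishes as \<open>n\<close>
  grows, which \<open>channel_waiting_Markov\<close> cannot give.\<close>

lemma channel_waiting_Chebyshev:
  assumes P: "waiting_law P" and ES: "0 < ES" and sq: "integrable P (\<lambda>x. x\<^sup>2)" and n: "0 < n" and \<epsilon>: "0 < \<epsilon>"
  shows "measure (channel_space P ES) {\<omega> \<in> space (channel_space P ES).
      real n * \<epsilon> \<le> \<bar>(\<Sum>i<n. fst \<omega> (m, i)) - real n * (\<integral>x. x \<partial>P)\<bar>}
    \<le> (\<integral>x. (x - (\<integral>x. x \<partial>P))\<^sup>2 \<partial>P) / \<epsilon>\<^sup>2 / real n"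
proof -
  let ?N = "\<Pi>\<^sub>M _\<in>(UNIV::(nat\<times>nat) set). P"
  let ?A = "{x \<in> space ?N. real n * \<epsilon> \<le> \<bar>(\<Sum>i<n. x (m, i)) - real n * (\<integral>x. x \<partial>P)\<bar>}"
  note [measurable_cong] = waiting_lawD(2)[OF P]
  have "measure ?N ?A \<le> (\<integral>x. (x - (\<integral>x. x \<partial>P))\<^sup>2 \<partial>P) / \<epsilon>\<^sup>2 / real n"
    by (rule iid_sum_Chebyshev[OF waiting_lawD(1,2)[OF P] sq _ n \<epsilon>]) (simp add: inj_def)
  also have "measure ?N ?A = measure (distr (channel_space P ES) ?N fst) ?A"
    by (simp only: distr_channel_fst[OF P ES])
  also have "\<dots> = measure (channel_space P ES) {\<omega> \<in> space (channel_space P ES).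
      real n * \<epsilon> \<le> \<bar>(\<Sum>i<n. fst \<omega> (m, i)) - real n * (\<integral>x. x \<partial>P)\<bar>}"
  proof (subst measure_distr)
    show "?A \<in> sets ?N" by measurable
  qed (auto intro!: arg_cong2[where f=measure] measurable_channel_fst P ES
      simp: space_channel[OF P ES] space_PiM waiting_lawD[OF P])
  finally show ?thesis .
qed

subsection \<open>Threshold decoding\<close>

text \<open>Under \<open>optimal_waiting\<close> the log-likelihood ratio of the sent message has
  mean \<open>n\<close>, so a threshold with \<open>\<theta> < 1\<close> is passed with high
  probability.\<close>

definition accepts :: "real \<Rightarrow> real \<Rightarrow> nat \<Rightarrow> (nat \<times> nat \<Rightarrow> real) \<Rightarrow> (nat \<Rightarrow> real) \<Rightarrow> nat \<Rightarrow> bool" where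
  "accepts ES \<theta> n cb d m \<longleftrightarrow> exp (\<theta> * real n) < (\<Prod>i<n. lratio ES (cb (m, i)) (d i))"

text \<open>Up to a null set, failure requires a deviation of the waiting or delay sum, or a wrong
  acceptance. Chebyshev bounds the first two, and the union bound over messages gives the last
  term.\<close>

lemma decoding_failure:
  fixes ES \<theta> \<epsilon> t :: real and n M m :: nat
  defines "K \<equiv> channel_space (optimal_waiting ES) ES"
    and "v \<equiv> (\<integral>x. (x - (\<integral>x. x \<partial>optimal_waiting ES))\<^sup>2 \<partial>optimal_waiting ES)"
  assumes ES: "0 < ES" and n: "0 < n" and m: "m < M" and \<epsilon>: "0 < \<epsilon>" "\<epsilon> \<le> (1 - \<theta>) * ES"
    and t: "real n * (exp 1 * ES + 2 * \<epsilon>) \<le> t"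
  shows "measure K {\<omega> \<in> space K. \<not> ((\<forall>k\<in>{1..n}. (\<Sum>i<k. inter_time (fst \<omega>) (snd \<omega>) m i) \<le> t)
       \<and> (\<forall>m'<M. accepts ES \<theta> n (fst \<omega>) (inter_time (fst \<omega>) (snd \<omega>) m) m' \<longleftrightarrow> m' = m))}
     \<le> (v + ES\<^sup>2) / \<epsilon>\<^sup>2 / real n + real M * exp (- \<theta> * real n)" (is "measure K ?A \<le> _")
proof -
  note P = waiting_law_optimal_waiting[OF ES]
  interpret K: prob_space K unfolding K_def by (rule prob_space_channel[OF P ES])
  note [measurable] = measurable_channel_waiting[OF P ES, folded K_def] measurable_channel_delay[OF P ES, folded K_def]
  let ?W = "\<lambda>\<omega>. \<Sum>i<n. fst \<omega> (m, i)" and ?S = "\<lambda>\<omega>. \<Sum>i<n. snd \<omega> i"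
  let ?Bw = "{\<omega> \<in> space K. real n * \<epsilon> \<le> \<bar>?W \<omega> - real n * ((exp 1 - 1) * ES)\<bar>}"
  let ?Bs = "{\<omega> \<in> space K. real n * \<epsilon> \<le> \<bar>?S \<omega> - real n * ES\<bar>}"
  let ?F = "\<lambda>m'. {\<omega> \<in> space K. accepts ES \<theta> n (fst \<omega>) (inter_time (fst \<omega>) (snd \<omega>) m) m'}"
  have F: "?F m' \<in> sets K" for m'
    unfolding accepts_def inter_time_def by measurable
  have "AE \<omega> in K. \<forall>i. 0 \<le> fst \<omega> (m, i) \<and> 0 \<le> snd \<omega> i"
    unfolding AE_all_countable K_def using channel_AE_waiting[OF P ES] channel_AE_delay[OF P ES] by simp
  then have "AE \<omega> in K. \<omega> \<in> ?A \<longrightarrow> \<omega> \<in> (?Bw \<union> ?Bs) \<union> (\<Union>m'\<in>{..<M} - {m}. ?F m')"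
  proof eventually_elim
    case (elim \<omega>)
    show ?case
    proof (rule impI, rule ccontr)
      assume A: "\<omega> \<in> ?A" and notin: "\<omega> \<notin> (?Bw \<union> ?Bs) \<union> (\<Union>m'\<in>{..<M} - {m}. ?F m')"
      have w: "\<bar>?W \<omega> - real n * ((exp 1 - 1) * ES)\<bar> < real n * \<epsilon>" and s: "\<bar>?S \<omega> - real n * ES\<bar> < real n * \<epsilon>"
        and other: "\<And>m'. m' < M \<Longrightarrow> m' \<noteq> m \<Longrightarrow> \<not> accepts ES \<theta> n (fst \<omega>) (inter_time (fst \<omega>) (snd \<omega>) m) m'"
        using A notin by auto
      have "(\<Sum>i<k. inter_time (fst \<omega>) (snd \<omega>) m i) \<le> t" if "k \<in> {1..n}" for k
      proof -
        \<comment> \<open>Nonnegative increments make the last reception the latest one.\<close>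
        have "(\<Sum>i<k. inter_time (fst \<omega>) (snd \<omega>) m i) \<le> (\<Sum>i<n. inter_time (fst \<omega>) (snd \<omega>) m i)"
          using that elim by (intro sum_mono2) (auto simp: inter_time_def)
        also have "\<dots> = ?W \<omega> + ?S \<omega>" by (simp add: inter_time_def sum.distrib)
        also have "\<dots> \<le> real n * ((exp 1 - 1) * ES) + real n * \<epsilon> + (real n * ES + real n * \<epsilon>)"
          using w s by linarith
        also have "\<dots> \<le> t" using t by (simp add: algebra_simps)
        finally show ?thesis .
      qed
      moreover have "accepts ES \<theta> n (fst \<omega>) (inter_time (fst \<omega>) (snd \<omega>) m) m"
      proof -
        have "lratio ES (fst \<omega> (m, i)) (inter_time (fst \<omega>) (snd \<omega>) m i)
            = exp (1 + fst \<omega> (m, i) / (exp 1 * ES) - (1 - 1 / exp 1) / ES * snd \<omega> i)" for i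
        proof -
          have "1 + (fst \<omega> (m, i) + snd \<omega> i) / (exp 1 * ES) - snd \<omega> i / ES
              = 1 + fst \<omega> (m, i) / (exp 1 * ES) - (1 - 1 / exp 1) / ES * snd \<omega> i"
            using ES by (simp add: field_simps)
          then show ?thesis using elim by (auto simp: lratio_def inter_time_def not_less)
        qed
        then have "(\<Prod>i<n. lratio ES (fst \<omega> (m, i)) (inter_time (fst \<omega>) (snd \<omega>) m i))
            = exp (\<Sum>i<n. 1 + fst \<omega> (m, i) / (exp 1 * ES) - (1 - 1 / exp 1) / ES * snd \<omega> i)"
          by (simp add: exp_sum)
        also have "(\<Sum>i<n. 1 + fst \<omega> (m, i) / (exp 1 * ES) - (1 - 1 / exp 1) / ES * snd \<omega> i)
            = real n + ?W \<omega> / (exp 1 * ES) - (1 - 1 / exp 1) / ES * ?S \<omega>"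
          by (simp add: sum.distrib sum_subtractf sum_distrib_left sum_divide_distrib)
        finally have prod: "(\<Prod>i<n. lratio ES (fst \<omega> (m, i)) (inter_time (fst \<omega>) (snd \<omega>) m i))
            = exp (real n + ?W \<omega> / (exp 1 * ES) - (1 - 1 / exp 1) / ES * ?S \<omega>)" .
        have "(real n * ((exp 1 - 1) * ES) - real n * \<epsilon>) / (exp 1 * ES) < ?W \<omega> / (exp 1 * ES)"
          using w ES by (intro divide_strict_right_mono) (auto simp: abs_less_iff)
        moreover have "(1 - 1 / exp 1) / ES * ?S \<omega> \<le> (1 - 1 / exp 1) / ES * (real n * ES + real n * \<epsilon>)"
          using s ES by (intro mult_left_mono) auto
        ultimately have "real n + (real n * ((exp 1 - 1) * ES) - real n * \<epsilon>) / (exp 1 * ES)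
              - (1 - 1 / exp 1) / ES * (real n * ES + real n * \<epsilon>)
            < real n + ?W \<omega> / (exp 1 * ES) - (1 - 1 / exp 1) / ES * ?S \<omega>"
          by linarith
        \<comment> \<open>The coefficients \<open>1 / (exp 1 * ES)\<close> and
          \<open>(1 - 1 / exp 1) / ES\<close> add up to \<open>1 / ES\<close>, so both deviations
          together cost \<open>n * \<epsilon> / ES\<close>.\<close>
        moreover have "real n + (real n * ((exp 1 - 1) * ES) - real n * \<epsilon>) / (exp 1 * ES)
              - (1 - 1 / exp 1) / ES * (real n * ES + real n * \<epsilon>) = real n * (1 - \<epsilon> / ES)"
          using ES by (simp add: field_simps)
        moreover have "\<theta> * real n \<le> real n * (1 - \<epsilon> / ES)"
        proof -
          have "\<epsilon> / ES \<le> 1 - \<theta>" using \<epsilon> ES by (simp add: pos_divide_le_eq)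
          then have "real n * \<theta> \<le> real n * (1 - \<epsilon> / ES)" by (intro mult_left_mono) auto
          then show ?thesis by (simp add: mult.commute)
        qed
        ultimately have "\<theta> * real n < real n + ?W \<omega> / (exp 1 * ES) - (1 - 1 / exp 1) / ES * ?S \<omega>"
          by linarith
        then show ?thesis unfolding accepts_def prod by simp
      qed
      ultimately show False using A other by auto
    qed
  qed
  then have "K.prob ?A \<le> K.prob ((?Bw \<union> ?Bs) \<union> (\<Union>m'\<in>{..<M} - {m}. ?F m'))"
    using F by (intro K.finite_measure_mono_AE) auto
  also have "\<dots> \<le> K.prob (?Bw \<union> ?Bs) + K.prob (\<Union>m'\<in>{..<M} - {m}. ?F m')"
    using F by (intro measure_Un_le) auto
  also have "K.prob (?Bw \<union> ?Bs) \<le> K.prob ?Bw + K.prob ?Bs"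
    by (intro measure_Un_le) auto
  also have "K.prob (\<Union>m'\<in>{..<M} - {m}. ?F m') \<le> (\<Sum>m'\<in>{..<M} - {m}. K.prob (?F m'))"
    using F by (intro measure_UNION_le) auto
  also have "\<dots> \<le> (\<Sum>m'\<in>{..<M} - {m}. exp (- \<theta> * real n))"
    using false_acceptance[OF ES] unfolding K_def accepts_def by (intro sum_mono) auto
  also have "\<dots> \<le> real M * exp (- \<theta> * real n)"
    using m by simp
  also have "K.prob ?Bw \<le> v / \<epsilon>\<^sup>2 / real n"
    using channel_waiting_Chebyshev[OF P ES optimal_waiting_integrable_square[OF ES] n \<epsilon>(1), of m]
    by (simp add: K_def v_def optimal_waiting_mean[OF ES])
  also have "K.prob ?Bs \<le> ES\<^sup>2 / \<epsilon>\<^sup>2 / real n"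
    using channel_delay_Chebyshev[OF P ES n \<epsilon>(1)] by (simp add: K_def)
  finally show ?thesis by (simp add: add_divide_distrib)
qed

subsection \<open>Quantization and estimation\<close>

text \<open>Clamping by \<open>min\<close> and \<open>nat\<close> keeps the index below a positive
  \<open>M\<close> for every real \<open>x\<close>, as the bound on the state holds only almost
  surely.\<close>

definition quantize :: "real \<Rightarrow> nat \<Rightarrow> real \<Rightarrow> nat" where
  "quantize L M x = nat (min (int M - 1) \<lfloor>(x + L) * real M / (2 * L)\<rfloor>)"

text \<open>The left endpoint of the cell, so the error can reach a full cell width.\<close>

definition dequantize :: "real \<Rightarrow> nat \<Rightarrow> nat \<Rightarrow> real" where
  "dequantize L M m = 2 * L * real m / real M - L"

lemma quantize_less: "0 < M \<Longrightarrow> quantize L M x < M"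
  by (auto simp: quantize_def)

lemma quantize_measurable [measurable]: "quantize L M \<in> measurable borel (count_space UNIV)"
  unfolding quantize_def by measurable

lemma quantize_error:
  assumes L: "\<bar>x\<bar> < L" and M: "0 < M"
  shows "\<bar>x - dequantize L M (quantize L M x)\<bar> \<le> 2 * L / real M"
proof -
  have L0: "0 < L" using L by linarith
  define y where "y = (x + L) * real M / (2 * L)"
  have y: "0 \<le> y" "y < real M"
  proof -
    have "0 \<le> x + L" using L by linarith
    then show "0 \<le> y" using L0 by (simp add: y_def)
    show "y < real M" using L L0 M by (simp add: y_def pos_divide_less_eq)
  qed
  then have fl: "0 \<le> \<lfloor>y\<rfloor>" "\<lfloor>y\<rfloor> \<le> int M - 1" by (auto simp: floor_less_iff)
  then have q: "real (quantize L M x) = of_int \<lfloor>y\<rfloor>"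
    unfolding quantize_def y_def[symmetric] by (simp add: min_absorb2)
  have "x = 2 * L / real M * y - L"
    using L0 M by (simp add: y_def field_simps)
  then have "x - dequantize L M (quantize L M x) = 2 * L / real M * (y - of_int \<lfloor>y\<rfloor>)"
    unfolding dequantize_def q by (simp add: algebra_simps diff_divide_distrib)
  moreover have "\<bar>y - of_int \<lfloor>y\<rfloor>\<bar> \<le> 1" by linarith
  then have "2 * L / real M * \<bar>y - of_int \<lfloor>y\<rfloor>\<bar> \<le> 2 * L / real M * 1"
    using L0 by (intro mult_left_mono) auto
  ultimately show ?thesis using L0 by (simp add: abs_mult)
qed

text \<open>With high probability exactly one message is accepted, so the sum selects its cell.\<close>

definition threshold_estimate ::
    "real \<Rightarrow> real \<Rightarrow> real \<Rightarrow> real \<Rightarrow> nat \<Rightarrow> nat \<Rightarrow> real \<Rightarrow> (nat \<times> nat \<Rightarrow> real) \<Rightarrow> real list \<Rightarrow> real" where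
  "threshold_estimate a ES \<theta> L M n t cb ds =
     (if length ds = n
      then exp (a * t) * (\<Sum>m<M. if accepts ES \<theta> n cb ((!) ds) m then dequantize L M m else 0)
      else 0)"

lemma received_eq_iff:
  "received enc n t \<omega> = n \<longleftrightarrow> (\<forall>k\<in>{1..n}. (\<Sum>i<k. sys_D enc \<omega> i) \<le> t)"
proof
  assume "received enc n t \<omega> = n"
  then have "{k \<in> {1..n}. (\<Sum>i<k. sys_D enc \<omega> i) \<le> t} = {1..n}"
    unfolding received_def by (intro card_subset_eq) auto
  then show "\<forall>k\<in>{1..n}. (\<Sum>i<k. sys_D enc \<omega> i) \<le> t" by blast
next
  assume "\<forall>k\<in>{1..n}. (\<Sum>i<k. sys_D enc \<omega> i) \<le> t"
  then have "{k \<in> {1..n}. (\<Sum>i<k. sys_D enc \<omega> i) \<le> t} = {1..n}" by blast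
  then show "received enc n t \<omega> = n" unfolding received_def by simp
qed

text \<open>Eliminates the list of random length: the estimator's length test becomes a condition on
  partial sums, and the formula becomes visibly measurable.\<close>

lemma est_error_threshold:
  "est_error a enc (threshold_estimate a ES \<theta> L M n) n t \<omega> =
     \<bar>exp (a * t) * fst \<omega> -
       (if \<forall>k\<in>{1..n}. (\<Sum>i<k. sys_D enc \<omega> i) \<le> t
        then exp (a * t) * (\<Sum>m<M. if accepts ES \<theta> n (fst (snd \<omega>)) (sys_D enc \<omega>) m then dequantize L M m else 0)
        else 0)\<bar>"
proof -
  have "accepts ES \<theta> n cb ((!) (map (sys_D enc \<omega>) [0..<n])) m = accepts ES \<theta> n cb (sys_D enc \<omega>) m" for cb m
  proof -
    have "(\<Prod>i<n. lratio ES (cb (m, i)) (map (sys_D enc \<omega>) [0..<n] ! i)) = (\<Prod>i<n. lratio ES (cb (m, i)) (sys_D enc \<omega> i))"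
      by (intro prod.cong) auto
    then show ?thesis by (simp add: accepts_def)
  qed
  then show ?thesis
    unfolding est_error_def threshold_estimate_def received_eq_iff[symmetric] by auto
qed

section \<open>The joint space of initial state, codebook and delays\<close>

context
  fixes P \<mu> :: "real measure" and ES :: real and enc :: "real \<Rightarrow> nat"
  assumes P: "waiting_law P" and ES: "0 < ES" and \<mu>: "prob_space \<mu>" and sets_\<mu>: "sets \<mu> = sets borel"
    and enc: "enc \<in> measurable borel (count_space UNIV)"
begin

interpretation K: prob_space "channel_space P ES" by (rule prob_space_channel[OF P ES])
interpretation X: prob_space \<mu> by (rule \<mu>)

lemma space_sys: "space (sys_space \<mu> P ES) = UNIV"
  using sets_eq_imp_space_eq[OF sets_\<mu>] by (simp add: sys_space_def space_pair_measure space_channel[OF P ES])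

lemma prob_space_sys: "prob_space (sys_space \<mu> P ES)"
  unfolding sys_space_def by (intro prob_space_pair \<mu> K.prob_space_axioms)

lemma sys_measurable:
  shows sys_measurable_state: "fst \<in> borel_measurable (sys_space \<mu> P ES)"
    and sys_measurable_waiting: "(\<lambda>\<omega>. fst (snd \<omega>) j) \<in> borel_measurable (sys_space \<mu> P ES)"
    and sys_measurable_delay: "(\<lambda>\<omega>. snd (snd \<omega>) i) \<in> borel_measurable (sys_space \<mu> P ES)"
    and sys_measurable_codeword: "(\<lambda>\<omega>. fst (snd \<omega>) (enc (fst \<omega>), i)) \<in> borel_measurable (sys_space \<mu> P ES)"
    and sys_D_measurable: "(\<lambda>\<omega>. sys_D enc \<omega> i) \<in> borel_measurable (sys_space \<mu> P ES)"
proof -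
  have f: "fst \<in> measurable (sys_space \<mu> P ES) \<mu>" and s: "snd \<in> measurable (sys_space \<mu> P ES) (channel_space P ES)"
    by (simp_all add: sys_space_def)
  show 1: "fst \<in> borel_measurable (sys_space \<mu> P ES)"
    using f by (simp add: measurable_cong_sets[OF refl sets_\<mu>])
  show 2: "(\<lambda>\<omega>. fst (snd \<omega>) j) \<in> borel_measurable (sys_space \<mu> P ES)" for j
    by (rule measurable_compose[OF s measurable_channel_waiting[OF P ES]])
  show 3 [measurable]: "(\<lambda>\<omega>. snd (snd \<omega>) i) \<in> borel_measurable (sys_space \<mu> P ES)"
    by (rule measurable_compose[OF s measurable_channel_delay[OF P ES]])
  \<comment> \<open>The codeword index is random here; measurability survives because there are
    countably many messages.\<close>
  show 4 [measurable]: "(\<lambda>\<omega>. fst (snd \<omega>) (enc (fst \<omega>), i)) \<in> borel_measurable (sys_space \<mu> P ES)"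
    by (rule measurable_compose_countable[OF 2 measurable_compose[OF 1 enc]])
  show "(\<lambda>\<omega>. sys_D enc \<omega> i) \<in> borel_measurable (sys_space \<mu> P ES)"
    unfolding sys_D_def inter_time_def by measurable
qed

lemma est_error_threshold_measurable:
  "est_error a enc (threshold_estimate a ES \<theta> L M n) n t \<in> borel_measurable (sys_space \<mu> P ES)"
proof -
  note [measurable] = sys_measurable
  show ?thesis
    by (subst ext[OF est_error_threshold]) (unfold accepts_def, measurable)
qed

text \<open>The state selects the codeword independently of the codebook, and all entries have law
  \<open>P\<close>. Hence the selected entries also have law \<open>P\<close>, whatever the
  encoder.\<close>

lemma expected_Tn_eq: "expected_Tn \<mu> P ES enc n = real n * ((\<integral>x. x \<partial>P) + ES)"
proof -
  note [measurable] = sys_measurable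
  note [measurable_cong] = waiting_lawD(2)[OF P] sets_exp_delay[OF ES]
  interpret sys: prob_space "sys_space \<mu> P ES" by (rule prob_space_sys)
  have mW: "(\<lambda>\<omega>. fst (snd \<omega>) (enc (fst \<omega>), i)) \<in> measurable (sys_space \<mu> P ES) P" for i
    using sys_measurable_codeword by (simp add: measurable_cong_sets[OF refl waiting_lawD(2)[OF P]])
  have mS: "(\<lambda>\<omega>. snd (snd \<omega>) i) \<in> measurable (sys_space \<mu> P ES) (exp_delay ES)" for i
    using sys_measurable_delay by (simp add: measurable_cong_sets[OF refl sets_exp_delay[OF ES]])
  have dW: "distr (sys_space \<mu> P ES) P (\<lambda>\<omega>. fst (snd \<omega>) (enc (fst \<omega>), i)) = P" for i
  proof (rule measure_eqI)
    fix A assume "A \<in> sets (distr (sys_space \<mu> P ES) P (\<lambda>\<omega>. fst (snd \<omega>) (enc (fst \<omega>), i)))"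
    then have A [measurable]: "A \<in> sets P" by simp
    let ?X = "(\<lambda>\<omega>. fst (snd \<omega>) (enc (fst \<omega>), i)) -` A \<inter> space (sys_space \<mu> P ES)"
    have X: "?X \<in> sets (sys_space \<mu> P ES)"
      by (rule measurable_sets[OF mW A])
    have "emeasure (distr (sys_space \<mu> P ES) P (\<lambda>\<omega>. fst (snd \<omega>) (enc (fst \<omega>), i))) A = emeasure (sys_space \<mu> P ES) ?X"
      by (rule emeasure_distr[OF mW A])
    also have "\<dots> = (\<integral>\<^sup>+x. emeasure (channel_space P ES) (Pair x -` ?X) \<partial>\<mu>)"
      using X unfolding sys_space_def by (rule K.emeasure_pair_measure_alt)
    also have "\<dots> = (\<integral>\<^sup>+x. emeasure P A \<partial>\<mu>)"
    proof (rule nn_integral_cong)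
      fix x
      have "Pair x -` ?X = (\<lambda>\<omega>. fst \<omega> (enc x, i)) -` A \<inter> space (channel_space P ES)"
        by (auto simp: space_sys space_channel[OF P ES])
      also have "emeasure (channel_space P ES) \<dots> = emeasure (distr (channel_space P ES) P (\<lambda>\<omega>. fst \<omega> (enc x, i))) A"
        using measurable_channel_waiting[OF P ES] A
        by (subst emeasure_distr) (auto simp: measurable_cong_sets[OF refl waiting_lawD(2)[OF P]])
      finally show "emeasure (channel_space P ES) (Pair x -` ?X) = emeasure P A"
        by (simp add: distr_channel_waiting[OF P ES])
    qed
    finally show "emeasure (distr (sys_space \<mu> P ES) P (\<lambda>\<omega>. fst (snd \<omega>) (enc (fst \<omega>), i))) A = emeasure P A"
      by (simp add: X.emeasure_space_1)
  qed simp
  have dS: "distr (sys_space \<mu> P ES) (exp_delay ES) (\<lambda>\<omega>. snd (snd \<omega>) i) = exp_delay ES" for i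
  proof (rule measure_eqI)
    fix A assume "A \<in> sets (distr (sys_space \<mu> P ES) (exp_delay ES) (\<lambda>\<omega>. snd (snd \<omega>) i))"
    then have A [measurable]: "A \<in> sets (exp_delay ES)" by simp
    let ?Y = "(\<lambda>\<omega>. snd \<omega> i) -` A \<inter> space (channel_space P ES)"
    have Y: "?Y \<in> sets (channel_space P ES)"
      using measurable_channel_delay[OF P ES]
      by (intro measurable_sets[OF _ A]) (auto simp: measurable_cong_sets[OF refl sets_exp_delay[OF ES]])
    have "(\<lambda>\<omega>. snd (snd \<omega>) i) -` A \<inter> space (sys_space \<mu> P ES) = space \<mu> \<times> ?Y"
      using sets_eq_imp_space_eq[OF sets_\<mu>] by (auto simp: space_sys space_channel[OF P ES])
    then have "emeasure (distr (sys_space \<mu> P ES) (exp_delay ES) (\<lambda>\<omega>. snd (snd \<omega>) i)) A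
        = emeasure (sys_space \<mu> P ES) (space \<mu> \<times> ?Y)"
      by (subst emeasure_distr[OF mS A]) auto
    also have "\<dots> = emeasure (channel_space P ES) ?Y"
      using Y unfolding sys_space_def by (subst K.emeasure_pair_measure_Times) (auto simp: X.emeasure_space_1)
    also have "\<dots> = emeasure (distr (channel_space P ES) (exp_delay ES) (\<lambda>\<omega>. snd \<omega> i)) A"
      using measurable_channel_delay[OF P ES] A
      by (subst emeasure_distr) (auto simp: measurable_cong_sets[OF refl sets_exp_delay[OF ES]])
    finally show "emeasure (distr (sys_space \<mu> P ES) (exp_delay ES) (\<lambda>\<omega>. snd (snd \<omega>) i)) A = emeasure (exp_delay ES) A"
      by (simp add: distr_channel_delay[OF P ES])
  qed simp
  have iW: "integrable (sys_space \<mu> P ES) (\<lambda>\<omega>. fst (snd \<omega>) (enc (fst \<omega>), i))" for i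
    using waiting_lawD(5)[OF P] by (subst (asm) dW[of i, symmetric], subst (asm) integrable_distr_eq) (auto intro: mW)
  have eW: "sys.expectation (\<lambda>\<omega>. fst (snd \<omega>) (enc (fst \<omega>), i)) = (\<integral>x. x \<partial>P)" for i
    by (subst (2) dW[of i, symmetric], subst integral_distr) (auto intro: mW)
  have iS: "integrable (sys_space \<mu> P ES) (\<lambda>\<omega>. snd (snd \<omega>) i)" for i
    using exp_delay_integrable[OF ES] by (subst (asm) dS[of i, symmetric], subst (asm) integrable_distr_eq) (auto intro: mS)
  have eS: "sys.expectation (\<lambda>\<omega>. snd (snd \<omega>) i) = ES" for i
    using exp_delay_mean[OF ES] by (subst (asm) dS[of i, symmetric], subst (asm) integral_distr) (auto intro: mS)
  show ?thesis
    by (simp add: expected_Tn_def sys_D_def inter_time_def iW eW iS eS)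
qed

text \<open>Conditions on the initial state, which freezes the message and reduces estimation to
  decoding on the channel space.\<close>

lemma measure_sys_le:
  assumes A: "A \<in> sets (sys_space \<mu> P ES)" and b: "0 \<le> b"
    and le: "AE x in \<mu>. measure (channel_space P ES) (Pair x -` A) \<le> b"
  shows "measure (sys_space \<mu> P ES) A \<le> b"
proof -
  interpret sys: prob_space "sys_space \<mu> P ES" by (rule prob_space_sys)
  have "ennreal (measure (sys_space \<mu> P ES) A) = emeasure (sys_space \<mu> P ES) A"
    by (simp add: sys.emeasure_eq_measure)
  also have "\<dots> = (\<integral>\<^sup>+x. emeasure (channel_space P ES) (Pair x -` A) \<partial>\<mu>)"
    using A unfolding sys_space_def by (rule K.emeasure_pair_measure_alt)
  also have "\<dots> \<le> (\<integral>\<^sup>+x. ennreal b \<partial>\<mu>)"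
    using le by (intro nn_integral_mono_AE) (auto simp: K.emeasure_eq_measure intro!: ennreal_leI)
  also have "\<dots> = ennreal b" by (simp add: X.emeasure_space_1)
  finally show ?thesis using b by simp
qed

end

section \<open>Choice of rates and convergence of the estimation error\<close>

theorem theorem3:
  fixes a L ES \<Gamma> :: real and \<mu> :: "real measure" and f :: "real \<Rightarrow> real"
  assumes a_pos: "a > 0"
    and ES_pos: "ES > 0"
    and Gamma: "\<Gamma> > 1"
    and mu_prob: "prob_space \<mu>"
    and mu_density: "\<mu> = density lborel f"
    and f_meas: "f \<in> borel_measurable lborel"
    and f_nonneg: "\<And>x. f x \<ge> 0"
    and finite_entropy: "integrable lborel (\<lambda>x. f x * ln (f x))"
    and bounded: "AE x in \<mu>. \<bar>x\<bar> < L"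
    and capacity: "timing_capacity ES > a * \<Gamma>"
  shows "\<exists>(M :: nat \<Rightarrow> nat) (P :: nat \<Rightarrow> real measure) (enc :: nat \<Rightarrow> real \<Rightarrow> nat)
           (est :: nat \<Rightarrow> real \<Rightarrow> (nat \<times> nat \<Rightarrow> real) \<Rightarrow> real list \<Rightarrow> real).
     (\<forall>n. waiting_law (P n) \<and> enc n \<in> borel_measurable borel \<and> (\<forall>x. enc n x < M n) \<and>
          (\<forall>t. est_error a (enc n) (est n) n t \<in> borel_measurable (sys_space \<mu> (P n) ES))) \<and>
     (\<forall>t :: nat \<Rightarrow> real.
        (\<exists>l. (\<lambda>n. t n / expected_Tn \<mu> (P n) ES (enc n) n) \<longlonglongrightarrow> l \<and> 1 < l \<and> l \<le> \<Gamma>) \<longrightarrow>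
        (\<forall>\<epsilon>>0. (\<lambda>n. measure (sys_space \<mu> (P n) ES)
                   {\<omega> \<in> space (sys_space \<mu> (P n) ES). est_error a (enc n) (est n) n (t n) \<omega> > \<epsilon>})
                 \<longlonglongrightarrow> 0))"
proof -
  \<comment> \<open>Expected time is \<open>exp 1 * ES\<close> per symbol, so \<open>p\<close>
    bounds the limiting growth exponent of the system per symbol.\<close>
  define p where "p = a * \<Gamma> * (exp 1 * ES)"
  have "a * \<Gamma> < 1 / (exp 1 * ES)" using capacity timing_capacity_le[OF ES_pos] by linarith
  then have p: "p < 1" using ES_pos by (simp add: p_def field_simps)
  \<comment> \<open>The gap below 1 is quartered: growth at most \<open>p + g\<close>, message rate
    \<open>p + 2 * g\<close>, threshold \<open>p + 3 * g\<close>. Consecutive exponents differ by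
    \<open>g\<close>, giving decay \<open>exp (- g * n)\<close> twice.\<close>
  define g where "g = (1 - p) / 4"
  have g: "0 < g" "p + 3 * g < 1" using p by (simp_all add: g_def field_simps)
  define \<theta> where "\<theta> = p + 3 * g"
  define M where "M n = nat \<lceil>exp ((p + 2 * g) * real n)\<rceil>" for n
  have M: "0 < M n" "exp ((p + 2 * g) * real n) \<le> real (M n)" "real (M n) \<le> exp ((p + 2 * g) * real n) + 1" for n
    unfolding M_def by (auto simp: zero_less_ceiling intro: real_nat_ceiling_ge)
  let ?P = "optimal_waiting ES"
  note P = waiting_law_optimal_waiting[OF ES_pos]
  let ?v = "(\<integral>x. (x - (\<integral>x. x \<partial>?P))\<^sup>2 \<partial>?P)"
  define enc where "enc n = quantize L (M n)" for n
  define est where "est n = threshold_estimate a ES \<theta> L (M n) n" for n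
  have sets_\<mu>: "sets \<mu> = sets borel" by (simp add: mu_density)
  have enc: "enc n \<in> measurable borel (count_space UNIV)" for n by (simp add: enc_def)
  have enc_lt: "enc n x < M n" for n x by (simp add: enc_def quantize_less M)
  have est_meas: "est_error a (enc n) (est n) n t \<in> borel_measurable (sys_space \<mu> ?P ES)" for n t
    unfolding est_def by (rule est_error_threshold_measurable[OF P ES_pos mu_prob sets_\<mu> enc])
  have ET: "expected_Tn \<mu> ?P ES (enc n) n = real n * (exp 1 * ES)" for n
    by (simp add: expected_Tn_eq[OF P ES_pos mu_prob sets_\<mu> enc] optimal_waiting_mean[OF ES_pos] algebra_simps)
  have conv: "(\<lambda>n. measure (sys_space \<mu> ?P ES) {\<omega> \<in> space (sys_space \<mu> ?P ES). est_error a (enc n) (est n) n (t n) \<omega> > \<epsilon>}) \<longlonglongrightarrow> 0"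
    if lim: "(\<lambda>n. t n / expected_Tn \<mu> ?P ES (enc n) n) \<longlonglongrightarrow> l" and l: "1 < l" "l \<le> \<Gamma>" and \<epsilon>: "0 < \<epsilon>" for t l \<epsilon>
  proof -
    \<comment> \<open>The first bound secures acceptance of the true message; the second fits all
      receptions before \<open>t n\<close>, which eventually exceeds \<open>(1 + l) / 2\<close>
      times the expected time.\<close>
    define \<eta> where "\<eta> = min ((1 - \<theta>) * ES) ((l - 1) / 4 * (exp 1 * ES))"
    have \<eta>: "0 < \<eta>" "\<eta> \<le> (1 - \<theta>) * ES" "2 * \<eta> \<le> (l - 1) / 2 * (exp 1 * ES)"
      using g ES_pos l by (auto simp: \<eta>_def \<theta>_def min_def)
    let ?b = "\<lambda>n. (?v + ES\<^sup>2) / \<eta>\<^sup>2 / real n + 2 * exp (- g * real n)"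
    have ev_lo: "\<forall>\<^sub>F n in sequentially. (1 + l) / 2 < t n / expected_Tn \<mu> ?P ES (enc n) n"
      using l by (intro order_tendstoD(1)[OF lim]) auto
    have aES: "0 < a * (exp 1 * ES)" using a_pos ES_pos by simp
    have "a * (exp 1 * ES) * l \<le> p"
      using mult_left_mono[OF l(2), of "a * (exp 1 * ES)"] aES by (simp add: p_def mult_ac)
    moreover have "(\<lambda>n. a * (exp 1 * ES) * (t n / expected_Tn \<mu> ?P ES (enc n) n)) \<longlonglongrightarrow> a * (exp 1 * ES) * l"
      by (intro tendsto_mult tendsto_const lim)
    ultimately have ev_hi: "\<forall>\<^sub>F n in sequentially. a * (exp 1 * ES) * (t n / expected_Tn \<mu> ?P ES (enc n) n) < p + g"
      using g by (intro order_tendstoD(2)) auto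
    have exp_lim: "(\<lambda>n. c * exp (- g * real n)) \<longlonglongrightarrow> 0" for c
    proof -
      have "(\<lambda>n. c * exp (- g) ^ n) \<longlonglongrightarrow> c * 0"
        using g by (intro tendsto_mult tendsto_const LIMSEQ_power_zero) simp
      then show ?thesis by (simp add: exp_of_nat_mult[symmetric] mult.commute)
    qed
    have ev_small: "\<forall>\<^sub>F n in sequentially. 2 * L * exp (- g * real n) < \<epsilon>"
      by (rule order_tendstoD(2)[OF exp_lim \<epsilon>])
    have le: "\<forall>\<^sub>F n in sequentially. measure (sys_space \<mu> ?P ES)
        {\<omega> \<in> space (sys_space \<mu> ?P ES). est_error a (enc n) (est n) n (t n) \<omega> > \<epsilon>} \<le> ?b n"
      using ev_lo ev_hi ev_small eventually_gt_at_top[of 0]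
    proof eventually_elim
      case (elim n)
      have n: "0 < n" by (rule elim)
      have pos: "0 < real n * (exp 1 * ES)" using n ES_pos by simp
      have t_lo: "real n * (exp 1 * ES + 2 * \<eta>) \<le> t n"
      proof -
        have "real n * (exp 1 * ES + 2 * \<eta>) \<le> real n * (exp 1 * ES + (l - 1) / 2 * (exp 1 * ES))"
          using \<eta> by (intro mult_left_mono) auto
        also have "\<dots> = (1 + l) / 2 * (real n * (exp 1 * ES))" by (simp add: field_simps)
        also have "\<dots> < t n" using elim(1) pos unfolding ET by (simp add: pos_less_divide_eq)
        finally show ?thesis by simp
      qed
      have t_hi: "a * t n \<le> (p + g) * real n"
      proof -
        have "a * (exp 1 * ES) * (t n / (real n * (exp 1 * ES))) = a * t n / real n"
          using ES_pos by simp
        then show ?thesis using elim(2) n unfolding ET by (simp add: pos_divide_less_eq)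
      qed
      let ?b' = "(?v + ES\<^sup>2) / \<eta>\<^sup>2 / real n + real (M n) * exp (- \<theta> * real n)"
      have Mexp: "real (M n) * exp (- \<theta> * real n) \<le> 2 * exp (- g * real n)"
      proof -
        have "0 \<le> p" using a_pos Gamma ES_pos by (simp add: p_def)
        \<comment> \<open>This absorbs the rounding in \<open>M n\<close> into a factor 2.\<close>
        then have "1 \<le> exp ((p + 2 * g) * real n)" using g by simp
        then have "real (M n) \<le> 2 * exp ((p + 2 * g) * real n)" using M(3)[of n] by linarith
        then have "real (M n) * exp (- \<theta> * real n) \<le> 2 * exp ((p + 2 * g) * real n) * exp (- \<theta> * real n)"
          by (intro mult_right_mono) auto
        also have "\<dots> = 2 * exp (- g * real n)"
          by (simp add: \<theta>_def exp_add[symmetric] algebra_simps)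
        finally show ?thesis .
      qed
      let ?A = "{\<omega> \<in> space (sys_space \<mu> ?P ES). est_error a (enc n) (est n) n (t n) \<omega> > \<epsilon>}"
      have "measure (sys_space \<mu> ?P ES) ?A \<le> ?b'"
      proof (rule measure_sys_le[OF P ES_pos mu_prob sets_\<mu> enc])
        show "?A \<in> sets (sys_space \<mu> ?P ES)" using est_meas by measurable
        show "0 \<le> ?b'" by (intro add_nonneg_nonneg divide_nonneg_nonneg integral_nonneg_AE) auto
        show "AE x in \<mu>. measure (channel_space ?P ES) (Pair x -` ?A) \<le> ?b'"
          using bounded
        proof eventually_elim
          case (elim x)
          note x = elim
          let ?K = "channel_space ?P ES"
          interpret K: prob_space ?K by (rule prob_space_channel[OF P ES_pos])
          note [measurable] = measurable_channel_waiting[OF P ES_pos] measurable_channel_delay[OF P ES_pos]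
          let ?m = "enc n x"
          let ?B = "{\<omega> \<in> space ?K. \<not> ((\<forall>k\<in>{1..n}. (\<Sum>i<k. inter_time (fst \<omega>) (snd \<omega>) ?m i) \<le> t n)
             \<and> (\<forall>m'<M n. accepts ES \<theta> n (fst \<omega>) (inter_time (fst \<omega>) (snd \<omega>) ?m) m' \<longleftrightarrow> m' = ?m))}"
          have "Pair x -` ?A \<subseteq> ?B"
          proof (rule subsetI, rule ccontr)
            fix \<omega> assume A: "\<omega> \<in> Pair x -` ?A" and nB: "\<omega> \<notin> ?B"
            have D: "sys_D (enc n) (x, \<omega>) = inter_time (fst \<omega>) (snd \<omega>) ?m"
              by (simp add: sys_D_def fun_eq_iff)
            have all: "\<forall>k\<in>{1..n}. (\<Sum>i<k. inter_time (fst \<omega>) (snd \<omega>) ?m i) \<le> t n"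
              and acc: "\<And>m'. m' < M n \<Longrightarrow> accepts ES \<theta> n (fst \<omega>) (inter_time (fst \<omega>) (snd \<omega>) ?m) m' \<longleftrightarrow> m' = ?m"
              using nB by (auto simp: space_channel[OF P ES_pos])
            \<comment> \<open>Outside \<open>?B\<close> the only accepted message is the true one,
              so the sum collapses to its cell.\<close>
            have "(\<Sum>m'<M n. if accepts ES \<theta> n (fst \<omega>) (inter_time (fst \<omega>) (snd \<omega>) ?m) m' then dequantize L (M n) m' else 0)
                = (\<Sum>m'<M n. if m' = ?m then dequantize L (M n) m' else 0)"
              by (intro sum.cong refl) (simp add: acc)
            also have "\<dots> = dequantize L (M n) ?m" using enc_lt by simp
            finally have "est_error a (enc n) (est n) n (t n) (x, \<omega>) = \<bar>exp (a * t n) * x - exp (a * t n) * dequantize L (M n) ?m\<bar>"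
              unfolding est_def est_error_threshold D using all by simp
            also have "\<dots> = exp (a * t n) * \<bar>x - dequantize L (M n) ?m\<bar>"
              by (simp add: right_diff_distrib[symmetric] abs_mult)
            also have "\<dots> \<le> exp (a * t n) * (2 * L / real (M n))"
              using quantize_error[OF x M(1)] unfolding enc_def by (intro mult_left_mono) auto
            \<comment> \<open>The system's growth meets the cell width; the spare \<open>g\<close>
              in the message rate makes the product vanish.\<close>
            also have "\<dots> \<le> exp ((p + g) * real n) * (2 * L / exp ((p + 2 * g) * real n))"
              using x M t_hi by (intro mult_mono divide_left_mono) auto
            also have "\<dots> = 2 * L * exp (- g * real n)"
            proof -
              have "- g * real n = (p + g) * real n - (p + 2 * g) * real n" by (simp add: algebra_simps)
              then show ?thesis by (simp add: exp_diff)
            qed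
            also have "\<dots> < \<epsilon>" by fact
            finally show False using A by simp
          qed
          moreover have "?B \<in> sets ?K" unfolding accepts_def inter_time_def by measurable
          ultimately have "K.prob (Pair x -` ?A) \<le> K.prob ?B"
            by (intro K.finite_measure_mono) auto
          also have "\<dots> \<le> ?b'"
            by (rule decoding_failure[OF ES_pos n enc_lt \<eta>(1,2) t_lo])
          finally show ?case .
        qed
      qed
      then show ?case using Mexp by linarith
    qed
    have "?b \<longlonglongrightarrow> 0 + 0"
      by (intro tendsto_add exp_lim lim_const_over_n)
    then have lim_b: "?b \<longlonglongrightarrow> 0" by simp
    show ?thesis
      by (rule tendsto_sandwich[OF _ le tendsto_const lim_b]) simp
  qed
  show ?thesis
  proof (rule exI[of _ M], rule exI[of _ "\<lambda>_. ?P"], rule exI[of _ enc], rule exI[of _ est], intro conjI allI impI)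
    fix n
    show "waiting_law ?P" by (rule P)
    show "enc n \<in> borel_measurable borel"
      using measurable_compose[OF enc, of "\<lambda>x. x" borel] by simp
  next
    show "enc n x < M n" for n x by (rule enc_lt)
    show "est_error a (enc n) (est n) n t \<in> borel_measurable (sys_space \<mu> ?P ES)" for n t
      by (rule est_meas)
  next
    fix t :: "nat \<Rightarrow> real" and \<epsilon> :: real
    assume "\<exists>l. (\<lambda>n. t n / expected_Tn \<mu> ?P ES (enc n) n) \<longlonglongrightarrow> l \<and> 1 < l \<and> l \<le> \<Gamma>" "0 < \<epsilon>"
    then show "(\<lambda>n. measure (sys_space \<mu> ?P ES)
        {\<omega> \<in> space (sys_space \<mu> ?P ES). est_error a (enc n) (est n) n (t n) \<omega> > \<epsilon>}) \<longlonglongrightarrow> 0"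
      using conv by blast
  qed
qed

end
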